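(* Let $d\in\mathbb{N}$, $p\in(0,\infty)$ and $\alpha\in(0,\infty)$, let $\boldsymbol{\ell}:\mathbb{N}\to\mathbb{N}_{\ge 2}\cup\{\infty\}$ and $\boldsymbol{c}:\mathbb{N}\to\mathbb{N}\cup\{\infty\}$ be non-decreasing, and suppose that $\gamma^\ast(\boldsymbol{\ell},\boldsymbol{c})<\infty$. If $\alpha>\frac{d}{p}\cdot\gamma^\ast(\boldsymbol{\ell},\boldsymbol{c})$, then $A^{\alpha,p}_{\boldsymbol{\ell},\boldsymbol{c}}([0,1]^d)\hookrightarrow C([0,1]^d)$. Furthermore, for each $\gamma\in\bigl(\gamma^\ast(\boldsymbol{\ell},\boldsymbol{c}),\frac{p}{d}\alpha\bigr)$ we have the embedding $$A^{\alpha,p}_{\boldsymbol{\ell},\boldsymbol{c}}([0,1]^d)\hookrightarrow A^{\mu,\infty}_{\boldsymbol{\ell},\boldsymbol{c}}([0,1]^d)\qquad\text{with}\qquad \mu=\frac{p}{d+p}\Bigl(\alpha-\frac{d}{p}\gamma\Bigr).$$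
   Context: $\mathbb{N}=\{1,2,3,\dots\}$. Neural networks: a neural network is a tuple $\Phi=((A_1,b_1),\dots,(A_L,b_L))$ with $L\in\mathbb{N}$, $A_j\in\mathbb{R}^{N_j\times N_{j-1}}$, $b_j\in\mathbb{R}^{N_j}$, $N_0,\dots,N_L\in\mathbb{N}$. Put $L(\Phi):=L$ (number of layers), $d_{\mathrm{in}}(\Phi):=N_0$, $d_{\mathrm{out}}(\Phi):=N_L$, $W(\Phi):=\sum_{j=1}^L(\|A_j\|_{\ell^0}+\|b_j\|_{\ell^0})$, where $\|\cdot\|_{\ell^0}$ counts non-zero entries, and $\|\Phi\|_{\mathcal{NN}}:=\max_j\max\{\|A_j\|_\infty,\|b_j\|_\infty\}$, where $\|\cdot\|_\infty$ is the largest absolute value of an entry. With the ReLU $\varrho(x)=\max\{0,x\}$ acting componentwise and $T_jx=A_jx+b_j$, the realization is $R_\varrho\Phi:=T_L\circ(\varrho\circ T_{L-1})\circ\cdots\circ(\varrho\circ T_1):\mathbb{R}^{N_0}\to\mathbb{R}^{N_L}$. Approximation spaces: $\Sigma_n^{\boldsymbol{\ell},\boldsymbol{c}}$ is the set of all $R_\varrho\Phi$ with $d_{\mathrm{in}}(\Phi)=d$, $d_{\mathrm{out}}(\Phi)=1$, $W(\Phi)\le n$, $L(\Phi)\le\boldsymbol{\ell}(n)$, $\|\Phi\|_{\mathcal{NN}}\le\boldsymbol{c}(n)$. For $q\in(0,\infty]$, $s\in(0,\infty)$ and measurable $f:[0,1]^d\to\mathbb{R}$ let $d_q(f,\Sigma):=\inf_{g\in\Sigma}\|f-g\|_{L^q([0,1]^d)}$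 and $$\Gamma_{s,q}(f):=\max\Big\{\|f\|_{L^q([0,1]^d)},\ \sup_{n\in\mathbb{N}}\big[n^s\cdot d_q(f,\Sigma_n^{\boldsymbol{\ell},\boldsymbol{c}})\big]\Big\}\in[0,\infty],$$ $\|f\|_{A^{s,q}_{\boldsymbol{\ell},\boldsymbol{c}}}:=\inf\{t>0:\Gamma_{s,q}(f/t)\le1\}\in[0,\infty]$, and $A^{s,q}_{\boldsymbol{\ell},\boldsymbol{c}}([0,1]^d):=\{f\in L^q([0,1]^d):\|f\|_{A^{s,q}_{\boldsymbol{\ell},\boldsymbol{c}}}<\infty\}$ (a quasi-normed space). Complexity exponent: with $\boldsymbol{\ell}^\ast:=\sup_{n\in\mathbb{N}}\boldsymbol{\ell}(n)$ and $\mathbb{N}_{\le\boldsymbol{\ell}^\ast}:=\{L\in\mathbb{N}:L\le\boldsymbol{\ell}^\ast\}$, $$\gamma^\ast(\boldsymbol{\ell},\boldsymbol{c}):=\sup\Big\{\gamma\in[0,\infty):\exists\,L\in\mathbb{N}_{\le\boldsymbol{\ell}^\ast}:\ \limsup_{n\to\infty}\frac{(\boldsymbol{c}(n))^L\cdot n^{\lfloor L/2\rfloor}}{n^\gamma}\in(0,\infty]\Big\}.$$ $C([0,1]^d)$ carries the supremum norm. An embedding $X\hookrightarrow Y$ means that every $f\in X$ belongs to $Y$ (after possibly changing $f$ on a null set) and there is $C>0$ with $\|f\|_Y\le C\|f\|_X$ for all $f\in X$. *)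

theory Defs
  imports
    "HOL-Probability.Essential_Supremum"
    "HOL-Library.Countable_Set"
    "Jordan_Normal_Form.Matrix"
begin

section \<open>ReLU neural networks\<close>

text \<open>Entry \<open>j\<close> of the list (counted from \<open>0\<close>) is the layer \<open>(A_{j+1}, b_{j+1})\<close>.\<close>

type_synonym network = "(real mat \<times> real Matrix.vec) list"

definition neural_network :: "network \<Rightarrow> bool" where
  "neural_network \<Phi> \<longleftrightarrow> \<Phi> \<noteq> [] \<and>
     (\<exists>N :: nat \<Rightarrow> nat. (\<forall>j\<le>length \<Phi>. 1 \<le> N j) \<and>
        (\<forall>j<length \<Phi>. fst (\<Phi> ! j) \<in> carrier_mat (N (Suc j)) (N j) \<and>
                      snd (\<Phi> ! j) \<in> carrier_vec (N (Suc j))))"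

definition num_layers :: "network \<Rightarrow> nat" where
  "num_layers \<Phi> = length \<Phi>"

definition d_in :: "network \<Rightarrow> nat" where
  "d_in \<Phi> = dim_col (fst (hd \<Phi>))"

definition d_out :: "network \<Rightarrow> nat" where
  "d_out \<Phi> = dim_row (fst (last \<Phi>))"

definition mat_l0 :: "real mat \<Rightarrow> nat" where
  "mat_l0 A = card {(i, j). i < dim_row A \<and> j < dim_col A \<and> A $$ (i, j) \<noteq> 0}"

definition vec_l0 :: "real Matrix.vec \<Rightarrow> nat" where
  "vec_l0 b = card {i. i < dim_vec b \<and> vec_index b i \<noteq> 0}"

definition num_weights :: "network \<Rightarrow> nat" where
  "num_weights \<Phi> = (\<Sum>(A, b)\<leftarrow>\<Phi>. mat_l0 A + vec_l0 b)"

definition nn_norm :: "network \<Rightarrow> real" where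
  "nn_norm \<Phi> = Max (\<Union>(A, b)\<in>set \<Phi>. abs ` (elements_mat A \<union> vec_set b))"

definition relu :: "real \<Rightarrow> real" where
  "relu x = max 0 x"

text \<open>No activation after the last layer; the value for the empty list is a dummy.\<close>

fun realization :: "network \<Rightarrow> real Matrix.vec \<Rightarrow> real Matrix.vec" where
  "realization [] x = x"
| "realization [(A, b)] x = A *\<^sub>v x + b"
| "realization ((A, b) # T # \<Phi>) x = realization (T # \<Phi>) (map_vec relu (A *\<^sub>v x + b))"


section \<open>Approximation spaces on the unit cube\<close>

text \<open>
  Functions on \<open>[0,1]^d\<close> are represented by functions on \<open>real^'d\<close>, with \<open>d = CARD('d)\<close>,
  whose values outside the cube are irrelevant.  The all-ones vector is written \<open>1\<close>.
\<close>

abbreviation unit_cube :: "(real^'d) set" where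
  "unit_cube \<equiv> cbox 0 1"

text \<open>
  The coordinates of \<open>real^'d\<close> are listed in the order given by the bijection
  \<^term>\<open>from_nat_into UNIV\<close> from \<open>{..<CARD('d)}\<close> to \<open>'d\<close>.  The sets \<open>nn_functions\<close> below do
  not depend on this order, since the columns of the first matrix can be permuted.
\<close>

definition coords :: "real^'d \<Rightarrow> real Matrix.vec" where
  "coords x = Matrix.vec CARD('d) (\<lambda>i. vec_nth x (from_nat_into (UNIV :: 'd set) i))"

definition nn_functions :: "(nat \<Rightarrow> enat) \<Rightarrow> (nat \<Rightarrow> enat) \<Rightarrow> nat \<Rightarrow> (real^'d \<Rightarrow> real) set" where
  "nn_functions \<l> c n =
     {(\<lambda>x. vec_index (realization \<Phi> (coords x)) 0) | \<Phi>.
        neural_network \<Phi> \<and> d_in \<Phi> = CARD('d) \<and> d_out \<Phi> = 1 \<and>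
        num_weights \<Phi> \<le> n \<and> enat (num_layers \<Phi>) \<le> \<l> n \<and>
        ereal (nn_norm \<Phi>) \<le> ereal_of_enat (c n)}"

text \<open>The (quasi-)norm of \<open>L^q\<close> on the cube, for \<open>0 < q \<le> \<infinity>\<close>.\<close>

definition Lq_norm :: "ennreal \<Rightarrow> (real^'d \<Rightarrow> real) \<Rightarrow> ennreal" where
  "Lq_norm q f =
     (if q = \<infinity> then esssup (lebesgue_on unit_cube) (\<lambda>x. ennreal \<bar>f x\<bar>)
      else let I = (\<integral>\<^sup>+x. ennreal (\<bar>f x\<bar> powr enn2real q) \<partial>lebesgue_on unit_cube)
           in if I = \<infinity> then \<infinity> else ennreal (enn2real I powr (1 / enn2real q)))"

definition Lq_dist :: "ennreal \<Rightarrow> (real^'d \<Rightarrow> real) \<Rightarrow> (real^'d \<Rightarrow> real) set \<Rightarrow> ennreal" where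
  "Lq_dist q f S = (INF g\<in>S. Lq_norm q (\<lambda>x. f x - g x))"

definition approx_Gamma ::
  "(nat \<Rightarrow> enat) \<Rightarrow> (nat \<Rightarrow> enat) \<Rightarrow> real \<Rightarrow> ennreal \<Rightarrow> (real^'d \<Rightarrow> real) \<Rightarrow> ennreal" where
  "approx_Gamma \<l> c s q f =
     max (Lq_norm q f) (SUP n\<in>{1..}. ennreal (real n powr s) * Lq_dist q f (nn_functions \<l> c n))"

definition approx_norm ::
  "(nat \<Rightarrow> enat) \<Rightarrow> (nat \<Rightarrow> enat) \<Rightarrow> real \<Rightarrow> ennreal \<Rightarrow> (real^'d \<Rightarrow> real) \<Rightarrow> ennreal" where
  "approx_norm \<l> c s q f =
     Inf {ennreal t | t. 0 < t \<and> approx_Gamma \<l> c s q (\<lambda>x. f x / t) \<le> 1}"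

definition approx_space ::
  "(nat \<Rightarrow> enat) \<Rightarrow> (nat \<Rightarrow> enat) \<Rightarrow> real \<Rightarrow> ennreal \<Rightarrow> (real^'d \<Rightarrow> real) set" where
  "approx_space \<l> c s q =
     {f. f \<in> borel_measurable (lebesgue_on unit_cube) \<and> Lq_norm q f < \<infinity> \<and>
         approx_norm \<l> c s q f < \<infinity>}"

definition cont_space :: "(real^'d \<Rightarrow> real) set" where
  "cont_space = {f. continuous_on unit_cube f}"

definition sup_norm :: "(real^'d \<Rightarrow> real) \<Rightarrow> ennreal" where
  "sup_norm f = (SUP x\<in>unit_cube. ennreal \<bar>f x\<bar>)"

definition embeds ::
  "(real^'d \<Rightarrow> real) set \<Rightarrow> ((real^'d \<Rightarrow> real) \<Rightarrow> ennreal) \<Rightarrow>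
   (real^'d \<Rightarrow> real) set \<Rightarrow> ((real^'d \<Rightarrow> real) \<Rightarrow> ennreal) \<Rightarrow> bool" where
  "embeds X norm\<^sub>X Y norm\<^sub>Y \<longleftrightarrow>
     (\<exists>C::real. 0 < C \<and>
        (\<forall>f\<in>X. \<exists>g\<in>Y. (AE x in lebesgue_on unit_cube. g x = f x) \<and>
           norm\<^sub>Y g \<le> ennreal C * norm\<^sub>X f))"


section \<open>The complexity exponent\<close>

definition gamma_star :: "(nat \<Rightarrow> enat) \<Rightarrow> (nat \<Rightarrow> enat) \<Rightarrow> ereal" where
  "gamma_star \<l> c =
     Sup {ereal \<gamma> | \<gamma>. 0 \<le> \<gamma> \<and>
       (\<exists>L::nat. 1 \<le> L \<and> enat L \<le> (SUP n\<in>{1..}. \<l> n) \<and>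
          0 < limsup (\<lambda>n. ereal_of_enat (c n) ^ L * ereal (real n ^ (L div 2))
                            / ereal (real n powr \<gamma>)))}"

end

theory Submission
  imports Defs
begin

text \<open>
  If \<open>\<gamma> > \<gamma>\<^sup>*\<close>, the functions in \<open>\<Sigma>\<^sub>n\<close> are Lipschitz with constant \<open>O(n\<^sup>\<gamma>)\<close>.  A function that is
  Lipschitz and small in \<open>L\<^sup>p\<close> is small uniformly, since it cannot leave a peak quickly.  Hence
  for a function in the approximation space the near-best approximants with \<open>2\<^sup>k\<close> weights
  converge uniformly, with increments \<open>O(2 powr (- \<mu> k))\<close>.
\<close>

section \<open>ReLU networks\<close>

text \<open>The exponent \<mu> comes from a balance. Suppose the difference of the approximants at
  levels k and k+1 has Lipschitz constant of order 2^(\<gamma> k) and L^p size of order 2^(-\<alpha>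
  k). Comparison on a cube of side r bounds its values by a constant times 2^(\<gamma> k) r +
  2^(-\<alpha> k) r^(-d/p). With r = 2^(-(\<mu>+\<gamma>) k) both summands have order 2^(-\<mu> k)
  exactly if \<mu> (1 + d/p) = \<alpha> - \<gamma> d/p, and \<mu> > 0 means \<gamma> < p \<alpha> /
  d. Three obstacles shape the rest. For p < 1 there is no triangle inequality in L^p, so the
  estimates concern integrals of p-th powers. The sets of networks need not be closed under sums or
  large multiples; hence a difference of approximants is treated only as a Lipschitz function, and a
  constant is absorbed by shrinking the last layer. The quasi-norm is an infimum over scalings t, so
  one continuous representative has to serve all t.\<close>

lemma neural_network_single:
  "neural_network [(A, b)] \<longleftrightarrow> 1 \<le> dim_row A \<and> 1 \<le> dim_col A \<and> dim_vec b = dim_row A"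
proof
  assume "neural_network [(A, b)]"
  then obtain N where "\<forall>j\<le>1. 1 \<le> N j" "A \<in> carrier_mat (N 1) (N 0)" "b \<in> carrier_vec (N (1::nat))"
    unfolding neural_network_def by auto
  then show "1 \<le> dim_row A \<and> 1 \<le> dim_col A \<and> dim_vec b = dim_row A"
    by auto
next
  assume *: "1 \<le> dim_row A \<and> 1 \<le> dim_col A \<and> dim_vec b = dim_row A"
  show "neural_network [(A, b)]"
    unfolding neural_network_def
    using * by (auto intro!: exI[of _ "\<lambda>j. if j = 0 then dim_col A else dim_row A"] carrier_vecI)
qed

lemma neural_network_Cons:
  "neural_network ((A, b) # T # \<Phi>) \<longleftrightarrow>
     1 \<le> dim_row A \<and> 1 \<le> dim_col A \<and> dim_vec b = dim_row A \<and>
     d_in (T # \<Phi>) = dim_row A \<and> neural_network (T # \<Phi>)"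
  (is "_ \<longleftrightarrow> ?rhs")
proof
  assume "neural_network ((A, b) # T # \<Phi>)"
  then obtain N where pos: "\<forall>j\<le>Suc (Suc (length \<Phi>)). 1 \<le> N j"
    and dims: "\<And>j. j < Suc (Suc (length \<Phi>)) \<Longrightarrow>
        fst (((A, b) # T # \<Phi>) ! j) \<in> carrier_mat (N (Suc j)) (N j) \<and>
        snd (((A, b) # T # \<Phi>) ! j) \<in> carrier_vec (N (Suc j))"
    unfolding neural_network_def by auto
  have tail: "neural_network (T # \<Phi>)"
    unfolding neural_network_def
    using pos dims[of "Suc _"]
    by (auto intro!: exI[of _ "\<lambda>j. N (Suc j)"])
  have "1 \<le> N 0" "1 \<le> N 1" using pos by auto
  with tail dims[of 0] dims[of 1] show ?rhs
    by (auto simp: d_in_def)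
next
  assume *: ?rhs
  then obtain N where pos: "\<forall>j\<le>Suc (length \<Phi>). 1 \<le> N j"
    and dims: "\<And>j. j < Suc (length \<Phi>) \<Longrightarrow>
        fst ((T # \<Phi>) ! j) \<in> carrier_mat (N (Suc j)) (N j) \<and>
        snd ((T # \<Phi>) ! j) \<in> carrier_vec (N (Suc j))"
    unfolding neural_network_def by auto
  have N0: "N 0 = dim_row A"
    using dims[of 0] * by (auto simp: d_in_def)
  \<comment> \<open>A new first layer shifts the widths by one; position 0 takes the new input
    dimension.\<close>
  define N' where "N' = case_nat (dim_col A) N"
  have "1 \<le> N' j" if "j \<le> Suc (Suc (length \<Phi>))" for j
    using that pos * by (cases j) (auto simp: N'_def)
  moreover have "fst (((A, b) # T # \<Phi>) ! j) \<in> carrier_mat (N' (Suc j)) (N' j) \<and>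
        snd (((A, b) # T # \<Phi>) ! j) \<in> carrier_vec (N' (Suc j))" if "j < Suc (Suc (length \<Phi>))" for j
    using that dims N0 * by (cases j) (auto simp: N'_def intro: carrier_vecI)
  ultimately show "neural_network ((A, b) # T # \<Phi>)"
    unfolding neural_network_def by (auto intro!: exI[of _ N'])
qed

text \<open>The width function is eliminated in favour of conditions on neighbouring layers, so that
  inductions follow the recursion of \<open>realization\<close>: one layer, or a layer in front of a
  non-empty network.\<close>

lemma neural_network_induct [consumes 1, case_names single Cons]:
  assumes "neural_network \<Phi>"
    and "\<And>A b. 1 \<le> dim_row A \<Longrightarrow> 1 \<le> dim_col A \<Longrightarrow> dim_vec b = dim_row A \<Longrightarrow> P [(A, b)]"
    and "\<And>A b T \<Phi>. 1 \<le> dim_row A \<Longrightarrow> 1 \<le> dim_col A \<Longrightarrow> dim_vec b = dim_row A \<Longrightarrow>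
           d_in (T # \<Phi>) = dim_row A \<Longrightarrow> neural_network (T # \<Phi>) \<Longrightarrow> P (T # \<Phi>) \<Longrightarrow>
           P ((A, b) # T # \<Phi>)"
  shows "P \<Phi>"
  using assms(1)
proof (induction \<Phi> rule: induct_list012)
  case 1
  then show ?case by (simp add: neural_network_def)
next
  case (2 x)
  then show ?case using assms(2) by (cases x) (simp add: neural_network_single)
next
  case (3 x T \<Phi>)
  then show ?case using assms(3) by (cases x) (simp add: neural_network_Cons)
qed

section \<open>Entrywise weight bounds and Lipschitz constants of realizations\<close>

abbreviation weights :: "network \<Rightarrow> real set" where
  "weights \<Phi> \<equiv> \<Union>(A, b)\<in>set \<Phi>. elements_mat A \<union> vec_set b"

lemma mat_entry_in_elements:
  assumes "i < dim_row A" "j < dim_col A" shows "A $$ (i, j) \<in> elements_mat A"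
  by (rule elements_matI[OF carrier_matI[OF refl refl] assms refl])

text \<open>\<open>Max\<close> is meaningful only on a finite non-empty set. Since all widths are
  positive, the first matrix has an entry at (0, 0), and this makes the set of weights
  non-empty.\<close>

lemma nn_norm_le_iff:
  assumes "neural_network \<Phi>"
  shows "nn_norm \<Phi> \<le> C \<longleftrightarrow> (\<forall>w\<in>weights \<Phi>. \<bar>w\<bar> \<le> C)"
proof -
  have fin: "finite (\<Union>(A, b)\<in>set \<Phi>. abs ` (elements_mat A \<union> vec_set b))"
    by (auto simp: elements_mat_def vec_set_def)
  obtain A b \<Psi> where \<Phi>: "\<Phi> = (A, b) # \<Psi>" and pos: "1 \<le> dim_row A" "1 \<le> dim_col A"
    using assms by (induction rule: neural_network_induct) auto
  have "A $$ (0, 0) \<in> elements_mat A"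
    using pos by (intro mat_entry_in_elements) auto
  then have "(\<Union>(A, b)\<in>set \<Phi>. abs ` (elements_mat A \<union> vec_set b)) \<noteq> {}"
    using \<Phi> by auto
  then show ?thesis
    unfolding nn_norm_def by (subst Max_le_iff[OF fin]) auto
qed

lemma vec_index_affine_diff:
  fixes A :: "real mat"
  assumes "dim_vec b = dim_row A" "dim_vec x = dim_col A" "dim_vec y = dim_col A" "i < dim_row A"
  shows "\<bar>vec_index (A *\<^sub>v x + b) i - vec_index (A *\<^sub>v y + b) i\<bar>
           \<le> (\<Sum>j<dim_col A. \<bar>A $$ (i, j)\<bar> * \<bar>vec_index x j - vec_index y j\<bar>)"
proof -
  have "vec_index (A *\<^sub>v x + b) i - vec_index (A *\<^sub>v y + b) i
      = (\<Sum>j<dim_col A. A $$ (i, j) * (vec_index x j - vec_index y j))"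
    using assms
    by (simp add: scalar_prod_def sum_subtractf right_diff_distrib atLeast0LessThan)
  also have "\<bar>\<dots>\<bar> \<le> (\<Sum>j<dim_col A. \<bar>A $$ (i, j) * (vec_index x j - vec_index y j)\<bar>)"
    by (rule sum_abs)
  finally show ?thesis by (simp add: abs_mult)
qed

text \<open>Zero entries drop out of the sum, so the bound involves the number of weights and not
  the widths, on which \<open>nn_functions\<close> puts no explicit limit.\<close>

lemma sum_abs_mat_le:
  fixes A :: "real mat"
  assumes "\<forall>w\<in>elements_mat A. \<bar>w\<bar> \<le> C"
  shows "(\<Sum>i<dim_row A. \<Sum>j<dim_col A. \<bar>A $$ (i, j)\<bar>) \<le> real (mat_l0 A) * C"
proof -
  let ?I = "{..<dim_row A} \<times> {..<dim_col A}"
  let ?S = "{(i, j). i < dim_row A \<and> j < dim_col A \<and> A $$ (i, j) \<noteq> 0}"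
  have "(\<Sum>i<dim_row A. \<Sum>j<dim_col A. \<bar>A $$ (i, j)\<bar>) = (\<Sum>p\<in>?I. \<bar>A $$ p\<bar>)"
    by (simp add: sum.cartesian_product)
  also have "\<dots> = (\<Sum>p\<in>?S. \<bar>A $$ p\<bar>)"
    by (intro sum.mono_neutral_right) auto
  also have "\<dots> \<le> real (card ?S) * C"
    using assms by (intro sum_bounded_above) (auto intro!: mat_entry_in_elements)
  finally show ?thesis by (simp add: mat_l0_def)
qed

lemma relu_diff_le: "\<bar>relu a - relu b\<bar> \<le> \<bar>a - b\<bar>"
  by (auto simp: relu_def)

text \<open>
  A matrix with entries at most \<open>C\<close>, at most \<open>n\<close> of them non-zero, has norm at most \<open>C\<close> from
  \<open>\<ell>\<^sup>1\<close> to \<open>\<ell>\<^sup>\<infinity>\<close> and at most \<open>n C\<close> from \<open>\<ell>\<^sup>\<infinity>\<close> to \<open>\<ell>\<^sup>1\<close>.  Alternating between the two norms,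
  only every other layer costs a factor \<open>n\<close>.
\<close>

lemma realization_lipschitz:
  assumes "neural_network \<Phi>" and "\<forall>w\<in>weights \<Phi>. \<bar>w\<bar> \<le> C" and "num_weights \<Phi> \<le> n"
    and "0 \<le> C" and "dim_vec x = d_in \<Phi>" and "dim_vec y = d_in \<Phi>" and "i < d_out \<Phi>"
  shows "(\<Sum>j<d_in \<Phi>. \<bar>vec_index x j - vec_index y j\<bar>) \<le> \<delta> \<Longrightarrow>
           \<bar>vec_index (realization \<Phi> x) i - vec_index (realization \<Phi> y) i\<bar>
             \<le> C ^ length \<Phi> * real n ^ (length \<Phi> div 2) * \<delta>"
    and "\<forall>j<d_in \<Phi>. \<bar>vec_index x j - vec_index y j\<bar> \<le> \<delta> \<Longrightarrow>
           \<bar>vec_index (realization \<Phi> x) i - vec_index (realization \<Phi> y) i\<bar>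
             \<le> C ^ length \<Phi> * real n ^ (Suc (length \<Phi>) div 2) * \<delta>"
proof -
  have layer1: "\<bar>vec_index (A *\<^sub>v x + b) i - vec_index (A *\<^sub>v y + b) i\<bar> \<le> C * \<delta>"
    if "dim_vec b = dim_row A" "dim_vec x = dim_col A" "dim_vec y = dim_col A" "i < dim_row A"
      and w: "\<forall>w\<in>elements_mat A. \<bar>w\<bar> \<le> C"
      and \<delta>: "(\<Sum>j<dim_col A. \<bar>vec_index x j - vec_index y j\<bar>) \<le> \<delta>"
    for A b x y i \<delta>
  proof -
    have "\<bar>vec_index (A *\<^sub>v x + b) i - vec_index (A *\<^sub>v y + b) i\<bar>
        \<le> (\<Sum>j<dim_col A. \<bar>A $$ (i, j)\<bar> * \<bar>vec_index x j - vec_index y j\<bar>)"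
      using that by (intro vec_index_affine_diff)
    also have "\<dots> \<le> (\<Sum>j<dim_col A. C * \<bar>vec_index x j - vec_index y j\<bar>)"
      using that by (intro sum_mono mult_right_mono) (auto intro!: mat_entry_in_elements)
    also have "\<dots> \<le> C * \<delta>"
      using \<delta> \<open>0 \<le> C\<close> by (simp add: sum_distrib_left[symmetric] mult_left_mono)
    finally show ?thesis .
  qed
  have layer2: "(\<Sum>i<dim_row A. \<bar>vec_index (A *\<^sub>v x + b) i - vec_index (A *\<^sub>v y + b) i\<bar>)
      \<le> real n * C * \<delta>"
    if "dim_vec b = dim_row A" "dim_vec x = dim_col A" "dim_vec y = dim_col A" "1 \<le> dim_col A"
      and w: "\<forall>w\<in>elements_mat A. \<bar>w\<bar> \<le> C" and "mat_l0 A \<le> n"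
      and \<delta>: "\<forall>j<dim_col A. \<bar>vec_index x j - vec_index y j\<bar> \<le> \<delta>"
    for A b x y \<delta>
  proof -
    have "0 \<le> \<delta>" using \<delta> \<open>1 \<le> dim_col A\<close> abs_ge_zero order_trans by (metis less_eq_Suc_le One_nat_def)
    have "(\<Sum>i<dim_row A. \<bar>vec_index (A *\<^sub>v x + b) i - vec_index (A *\<^sub>v y + b) i\<bar>)
        \<le> (\<Sum>i<dim_row A. \<Sum>j<dim_col A. \<bar>A $$ (i, j)\<bar> * \<bar>vec_index x j - vec_index y j\<bar>)"
      using that by (intro sum_mono vec_index_affine_diff) auto
    also have "\<dots> \<le> (\<Sum>i<dim_row A. \<Sum>j<dim_col A. \<bar>A $$ (i, j)\<bar> * \<delta>)"
      using \<delta> by (intro sum_mono mult_left_mono) auto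
    also have "\<dots> = (\<Sum>i<dim_row A. \<Sum>j<dim_col A. \<bar>A $$ (i, j)\<bar>) * \<delta>"
      by (simp add: sum_distrib_right)
    also have "\<dots> \<le> (real (mat_l0 A) * C) * \<delta>"
      using sum_abs_mat_le[OF w] \<open>0 \<le> \<delta>\<close> by (rule mult_right_mono)
    also have "\<dots> \<le> real n * C * \<delta>"
      using \<open>mat_l0 A \<le> n\<close> \<open>0 \<le> C\<close> \<open>0 \<le> \<delta>\<close> by (intro mult_right_mono) auto
    finally show ?thesis .
  qed
  \<comment> \<open>The two bounds are proved simultaneously and for all \<delta>: a layer turns
    control in one norm into control in the other with a new \<delta>, so each bound uses the
    induction hypothesis of the other.\<close>
  have "(\<forall>\<delta>. (\<Sum>j<d_in \<Phi>. \<bar>vec_index x j - vec_index y j\<bar>) \<le> \<delta> \<longrightarrow>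
           \<bar>vec_index (realization \<Phi> x) i - vec_index (realization \<Phi> y) i\<bar>
             \<le> C ^ length \<Phi> * real n ^ (length \<Phi> div 2) * \<delta>) \<and>
    (\<forall>\<delta>. (\<forall>j<d_in \<Phi>. \<bar>vec_index x j - vec_index y j\<bar> \<le> \<delta>) \<longrightarrow>
           \<bar>vec_index (realization \<Phi> x) i - vec_index (realization \<Phi> y) i\<bar>
             \<le> C ^ length \<Phi> * real n ^ (Suc (length \<Phi>) div 2) * \<delta>)"
    using assms
  proof (induction arbitrary: x y rule: neural_network_induct)
    case (single A b)
    then have dims: "dim_vec b = dim_row A" "dim_vec x = dim_col A" "dim_vec y = dim_col A"
        "i < dim_row A" "\<forall>w\<in>elements_mat A. \<bar>w\<bar> \<le> C" "mat_l0 A \<le> n"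
      by (auto simp: d_in_def d_out_def num_weights_def)
    have "\<bar>vec_index (A *\<^sub>v x + b) i - vec_index (A *\<^sub>v y + b) i\<bar> \<le> real n * C * \<delta>"
      if "\<forall>j<dim_col A. \<bar>vec_index x j - vec_index y j\<bar> \<le> \<delta>" for \<delta>
    proof -
      have "\<bar>vec_index (A *\<^sub>v x + b) i - vec_index (A *\<^sub>v y + b) i\<bar>
          \<le> (\<Sum>i<dim_row A. \<bar>vec_index (A *\<^sub>v x + b) i - vec_index (A *\<^sub>v y + b) i\<bar>)"
        using dims by (intro member_le_sum) auto
      with layer2[of b A x y \<delta>] dims single(2) that show ?thesis by simp
    qed
    with layer1[of b A x y i] dims show ?case
      by (auto simp: d_in_def mult_ac)
  next
    case (Cons A b T \<Phi>)
    have dims: "dim_vec b = dim_row A" "dim_vec x = dim_col A" "dim_vec y = dim_col A"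
        "1 \<le> dim_col A" "\<forall>w\<in>elements_mat A. \<bar>w\<bar> \<le> C" "mat_l0 A \<le> n"
      using Cons.hyps Cons.prems by (auto simp: d_in_def num_weights_def)
    define x' where "x' = map_vec relu (A *\<^sub>v x + b)"
    define y' where "y' = map_vec relu (A *\<^sub>v y + b)"
    have relu: "\<bar>vec_index x' j - vec_index y' j\<bar>
        \<le> \<bar>vec_index (A *\<^sub>v x + b) j - vec_index (A *\<^sub>v y + b) j\<bar>" if "j < dim_row A" for j
      using that dims relu_diff_le[of "vec_index (A *\<^sub>v x + b) j" "vec_index (A *\<^sub>v y + b) j"]
      by (simp add: x'_def y'_def)
    have IH: "(\<Sum>j<d_in (T # \<Phi>). \<bar>vec_index x' j - vec_index y' j\<bar>) \<le> \<delta> \<Longrightarrow>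
           \<bar>vec_index (realization (T # \<Phi>) x') i - vec_index (realization (T # \<Phi>) y') i\<bar>
             \<le> C ^ length (T # \<Phi>) * real n ^ (length (T # \<Phi>) div 2) * \<delta>"
      "\<forall>j<d_in (T # \<Phi>). \<bar>vec_index x' j - vec_index y' j\<bar> \<le> \<delta> \<Longrightarrow>
           \<bar>vec_index (realization (T # \<Phi>) x') i - vec_index (realization (T # \<Phi>) y') i\<bar>
             \<le> C ^ length (T # \<Phi>) * real n ^ (Suc (length (T # \<Phi>)) div 2) * \<delta>" for \<delta>
    proof -
      have 1: "\<forall>w\<in>weights (T # \<Phi>). \<bar>w\<bar> \<le> C" "num_weights (T # \<Phi>) \<le> n" "i < d_out (T # \<Phi>)"
        using Cons.prems by (auto simp: d_out_def num_weights_def)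
      have 2: "dim_vec x' = d_in (T # \<Phi>)" "dim_vec y' = d_in (T # \<Phi>)"
        using Cons.hyps by (simp_all add: x'_def y'_def)
      note IH = Cons.IH[OF 1(1,2) \<open>0 \<le> C\<close> 2 1(3)]
      show "(\<Sum>j<d_in (T # \<Phi>). \<bar>vec_index x' j - vec_index y' j\<bar>) \<le> \<delta> \<Longrightarrow>
           \<bar>vec_index (realization (T # \<Phi>) x') i - vec_index (realization (T # \<Phi>) y') i\<bar>
             \<le> C ^ length (T # \<Phi>) * real n ^ (length (T # \<Phi>) div 2) * \<delta>"
        by (rule IH[THEN conjunct1, rule_format])
      show "\<forall>j<d_in (T # \<Phi>). \<bar>vec_index x' j - vec_index y' j\<bar> \<le> \<delta> \<Longrightarrow>
           \<bar>vec_index (realization (T # \<Phi>) x') i - vec_index (realization (T # \<Phi>) y') i\<bar>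
             \<le> C ^ length (T # \<Phi>) * real n ^ (Suc (length (T # \<Phi>)) div 2) * \<delta>"
        by (rule IH[THEN conjunct2, rule_format]) blast
    qed
    \<comment> \<open>Input controlled in l1: the first layer costs only C, and the remaining
      exponent \<open>Suc (length (T # \<Phi>)) div 2\<close> is already half the full
      depth.\<close>
    have "\<bar>vec_index (realization (T # \<Phi>) x') i - vec_index (realization (T # \<Phi>) y') i\<bar>
             \<le> C ^ length (T # \<Phi>) * real n ^ (Suc (length (T # \<Phi>)) div 2) * (C * \<delta>)"
      if "(\<Sum>j<dim_col A. \<bar>vec_index x j - vec_index y j\<bar>) \<le> \<delta>" for \<delta>
    proof (rule IH(2), intro allI impI)
      fix j assume "j < d_in (T # \<Phi>)"
      with Cons.hyps have "j < dim_row A" by simp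
      from relu[OF this] layer1[of b A x y j \<delta>] this dims that
      show "\<bar>vec_index x' j - vec_index y' j\<bar> \<le> C * \<delta>" by simp
    qed
    \<comment> \<open>Input controlled in the sup norm: the first layer costs n C, and the extra
      factor n raises the exponent of n by one, which again matches the claim for the full
      depth.\<close>
    moreover have "\<bar>vec_index (realization (T # \<Phi>) x') i - vec_index (realization (T # \<Phi>) y') i\<bar>
             \<le> C ^ length (T # \<Phi>) * real n ^ (length (T # \<Phi>) div 2) * (real n * C * \<delta>)"
      if "\<forall>j<dim_col A. \<bar>vec_index x j - vec_index y j\<bar> \<le> \<delta>" for \<delta>
    proof (rule IH(1))
      have "(\<Sum>j<d_in (T # \<Phi>). \<bar>vec_index x' j - vec_index y' j\<bar>)
          \<le> (\<Sum>j<dim_row A. \<bar>vec_index (A *\<^sub>v x + b) j - vec_index (A *\<^sub>v y + b) j\<bar>)"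
        unfolding Cons.hyps(4) using relu by (intro sum_mono) simp
      also have "\<dots> \<le> real n * C * \<delta>"
        using layer2 dims that by blast
      finally show "(\<Sum>j<d_in (T # \<Phi>). \<bar>vec_index x' j - vec_index y' j\<bar>) \<le> real n * C * \<delta>" .
    qed
    ultimately show ?case
      by (auto simp: d_in_def x'_def[symmetric] y'_def[symmetric] mult_ac)
  qed
  then show "(\<Sum>j<d_in \<Phi>. \<bar>vec_index x j - vec_index y j\<bar>) \<le> \<delta> \<Longrightarrow>
           \<bar>vec_index (realization \<Phi> x) i - vec_index (realization \<Phi> y) i\<bar>
             \<le> C ^ length \<Phi> * real n ^ (length \<Phi> div 2) * \<delta>"
    and "\<forall>j<d_in \<Phi>. \<bar>vec_index x j - vec_index y j\<bar> \<le> \<delta> \<Longrightarrow>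
           \<bar>vec_index (realization \<Phi> x) i - vec_index (realization \<Phi> y) i\<bar>
             \<le> C ^ length \<Phi> * real n ^ (Suc (length \<Phi>) div 2) * \<delta>"
    by simp_all
qed

section \<open>Multiplying the output of a network by a scalar\<close>

text \<open>Only the last layer is multiplied. No activation follows it, so the realization is
  multiplied by s whatever the sign of s, and the depth stays the same.\<close>

fun scale_output :: "real \<Rightarrow> network \<Rightarrow> network" where
  "scale_output s [] = []"
| "scale_output s [(A, b)] = [(s \<cdot>\<^sub>m A, s \<cdot>\<^sub>v b)]"
| "scale_output s (l # T # \<Phi>) = l # scale_output s (T # \<Phi>)"

lemma scale_output_simps:
  "length (scale_output s \<Phi>) = length \<Phi>"
  "\<Phi> \<noteq> [] \<Longrightarrow> d_in (scale_output s \<Phi>) = d_in \<Phi>"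
  "\<Phi> \<noteq> [] \<Longrightarrow> d_out (scale_output s \<Phi>) = d_out \<Phi>"
  "scale_output s \<Phi> = [] \<longleftrightarrow> \<Phi> = []"
proof -
  show len: "length (scale_output s \<Phi>) = length \<Phi>" for s \<Phi>
    by (induction s \<Phi> rule: scale_output.induct) auto
  show nil: "scale_output s \<Phi> = [] \<longleftrightarrow> \<Phi> = []" for s \<Phi>
    using len[of s \<Phi>] by (metis length_0_conv)
  show "\<Phi> \<noteq> [] \<Longrightarrow> d_in (scale_output s \<Phi>) = d_in \<Phi>"
    by (induction s \<Phi> rule: scale_output.induct) (simp_all add: d_in_def)
  show "\<Phi> \<noteq> [] \<Longrightarrow> d_out (scale_output s \<Phi>) = d_out \<Phi>"
    by (induction s \<Phi> rule: scale_output.induct) (simp_all add: d_out_def nil)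
qed

lemma neural_network_scale_output:
  assumes "neural_network \<Phi>"
  shows "neural_network (scale_output s \<Phi>)"
  using assms
proof (induction rule: neural_network_induct)
  case (single A b)
  then show ?case by (simp add: neural_network_single)
next
  case (Cons A b T \<Phi>)
  obtain T' \<Phi>' where T': "scale_output s (T # \<Phi>) = T' # \<Phi>'"
    using scale_output_simps(4)[of s "T # \<Phi>"] by (cases "scale_output s (T # \<Phi>)") auto
  have "d_in (T' # \<Phi>') = d_in (T # \<Phi>)"
    using scale_output_simps(2)[of "T # \<Phi>" s] T' by simp
  with Cons T' show ?case by (simp add: neural_network_Cons)
qed

lemma realization_scale_output:
  assumes "neural_network \<Phi>" and "dim_vec x = d_in \<Phi>" and "i < d_out \<Phi>"
  shows "vec_index (realization (scale_output s \<Phi>) x) i = s * vec_index (realization \<Phi> x) i"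
  using assms
proof (induction arbitrary: x rule: neural_network_induct)
  case (single A b)
  then show ?case by (simp add: d_in_def d_out_def algebra_simps)
next
  case (Cons A b T \<Phi>)
  obtain T' \<Phi>' where T': "scale_output s (T # \<Phi>) = T' # \<Phi>'"
    using scale_output_simps(4)[of s "T # \<Phi>"] by (cases "scale_output s (T # \<Phi>)") auto
  show ?case
    using Cons.IH[of "map_vec relu (A *\<^sub>v x + b)"] Cons.hyps Cons.prems T'
    by (simp add: d_out_def)
qed

lemma num_weights_scale_output:
  assumes "s \<noteq> 0"
  shows "num_weights (scale_output s \<Phi>) = num_weights \<Phi>"
proof -
  have "mat_l0 (s \<cdot>\<^sub>m A) = mat_l0 A" for A
    unfolding mat_l0_def using assms by (intro arg_cong[where f = card]) auto
  moreover have "vec_l0 (s \<cdot>\<^sub>v b) = vec_l0 b" for b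
    unfolding vec_l0_def using assms by (intro arg_cong[where f = card]) auto
  ultimately show ?thesis
    by (induction s \<Phi> rule: scale_output.induct) (auto simp: num_weights_def)
qed

lemma weights_scale_output:
  "w \<in> weights (scale_output s \<Phi>) \<Longrightarrow> \<exists>v\<in>weights \<Phi>. w = v \<or> w = s * v"
proof (induction s \<Phi> rule: scale_output.induct)
  case (2 s A b)
  then consider i j where "i < dim_row A" "j < dim_col A" "w = s * A $$ (i, j)"
    | i where "i < dim_vec b" "w = s * vec_index b i"
    by (auto simp: vec_set_def dest!: elements_matD)
  then show ?case
  proof cases
    case 1
    with mat_entry_in_elements show ?thesis by (intro bexI[of _ "A $$ (i, j)"]) auto
  next
    case 2
    then show ?thesis by (intro bexI[of _ "vec_index b i"]) (auto simp: vec_set_def)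
  qed
qed auto

lemma nn_norm_scale_output:
  assumes "neural_network \<Phi>" and "\<bar>s\<bar> \<le> 1"
  shows "nn_norm (scale_output s \<Phi>) \<le> nn_norm \<Phi>"
proof -
  have "\<bar>w\<bar> \<le> nn_norm \<Phi>" if w: "w \<in> weights (scale_output s \<Phi>)" for w
  proof -
    from weights_scale_output[OF w] obtain v where v: "v \<in> weights \<Phi>" "w = v \<or> w = s * v" by blast
    have "\<bar>v\<bar> \<le> nn_norm \<Phi>"
      using nn_norm_le_iff[OF assms(1), of "nn_norm \<Phi>"] v by blast
    moreover have "\<bar>s * v\<bar> \<le> \<bar>v\<bar>"
      using assms(2) by (simp add: abs_mult mult_left_le_one_le)
    ultimately show ?thesis using v by auto
  qed
  then show ?thesis
    by (subst nn_norm_le_iff[OF neural_network_scale_output[OF assms(1)]]) blast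
qed

text \<open>A large factor could violate the bound \<open>c n\<close> on the weights, whereas |s|
  \<le> 1 only shrinks the last layer, and s \<noteq> 0 keeps the number of non-zero weights. It is
  applied with s = 1 / C for a constant C \<ge> 1, to normalise an approximation error.\<close>

lemma nn_functions_scale:
  fixes g :: "real^'d \<Rightarrow> real"
  assumes "g \<in> nn_functions \<l> c n" and "s \<noteq> 0" and "\<bar>s\<bar> \<le> 1"
  shows "(\<lambda>x. s * g x) \<in> nn_functions \<l> c n"
proof -
  obtain \<Phi> where \<Phi>: "neural_network \<Phi>" "d_in \<Phi> = CARD('d)" "d_out \<Phi> = 1" "num_weights \<Phi> \<le> n"
      "enat (num_layers \<Phi>) \<le> \<l> n" "ereal (nn_norm \<Phi>) \<le> ereal_of_enat (c n)"
    and g: "g = (\<lambda>x. vec_index (realization \<Phi> (coords x)) 0)"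
    using assms(1) by (auto simp: nn_functions_def)
  have "\<Phi> \<noteq> []" using \<Phi> by (simp add: neural_network_def)
  have "ereal (nn_norm (scale_output s \<Phi>)) \<le> ereal_of_enat (c n)"
    using nn_norm_scale_output[OF \<Phi>(1) assms(3)] \<Phi>(6) by (meson ereal_less_eq(3) order_trans)
  moreover have "vec_index (realization (scale_output s \<Phi>) (coords x)) 0 = s * g x" for x :: "real^'d"
    unfolding g using \<Phi> by (intro realization_scale_output) (auto simp: coords_def)
  ultimately show ?thesis
    unfolding nn_functions_def mem_Collect_eq
    using \<Phi> \<open>\<Phi> \<noteq> []\<close> assms(2)
    by (intro exI[of _ "scale_output s \<Phi>"])
       (simp add: scale_output_simps num_layers_def neural_network_scale_output num_weights_scale_output)
qed

lemma nn_functions_mono: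
  assumes "n \<le> m" "\<l> n \<le> \<l> m" "c n \<le> c m"
  shows "nn_functions \<l> c n \<subseteq> nn_functions \<l> c m"
  using assms unfolding nn_functions_def
  by (force intro: order_trans)

text \<open>Measuring the input in l1 gives the exponent \<open>L div 2\<close> instead of
  \<open>Suc L div 2\<close>; this is the growth rate that occurs in
  \<open>gamma_star\<close>.\<close>

lemma nn_functions_lipschitz:
  fixes g :: "real^'d \<Rightarrow> real"
  assumes "g \<in> nn_functions \<l> c n" and "\<l> n \<le> enat L" and "c n = enat C" and "1 \<le> C" and "1 \<le> n"
  shows "\<bar>g x - g y\<bar> \<le> real C ^ L * real n ^ (L div 2) * (\<Sum>i\<in>UNIV. \<bar>vec_nth x i - vec_nth y i\<bar>)"
proof -
  obtain \<Phi> where \<Phi>: "neural_network \<Phi>" "d_in \<Phi> = CARD('d)" "d_out \<Phi> = 1" "num_weights \<Phi> \<le> n"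
      "enat (num_layers \<Phi>) \<le> \<l> n" "ereal (nn_norm \<Phi>) \<le> ereal_of_enat (c n)"
    and g: "g = (\<lambda>x. vec_index (realization \<Phi> (coords x)) 0)"
    using assms(1) by (auto simp: nn_functions_def)
  let ?\<delta> = "\<Sum>i\<in>UNIV. \<bar>vec_nth x i - vec_nth y i\<bar>"
  have "nn_norm \<Phi> \<le> real C" using \<Phi>(6) assms(3) by simp
  then have w: "\<forall>w\<in>weights \<Phi>. \<bar>w\<bar> \<le> real C"
    using nn_norm_le_iff[OF \<Phi>(1)] by blast
  have len: "length \<Phi> \<le> L"
    using \<Phi>(5) assms(2) by (simp add: num_layers_def) (metis enat_ord_simps(1) order_trans)
  have "bij_betw (from_nat_into (UNIV :: 'd set)) {..<CARD('d)} UNIV"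
    by (intro bij_betw_from_nat_into_finite) simp
  from sum.reindex_bij_betw[OF this, of "\<lambda>i. \<bar>vec_nth x i - vec_nth y i\<bar>"]
  have "(\<Sum>j<d_in \<Phi>. \<bar>vec_index (coords x) j - vec_index (coords y) j\<bar>) = ?\<delta>"
    using \<Phi> by (simp add: coords_def)
  then have "\<bar>g x - g y\<bar> \<le> real C ^ length \<Phi> * real n ^ (length \<Phi> div 2) * ?\<delta>"
    unfolding g using \<Phi> w by (intro realization_lipschitz(1)) (auto simp: coords_def)
  \<comment> \<open>The network may have fewer than L layers; the bound increases with the depth
    because C \<ge> 1 and n \<ge> 1.\<close>
  also have "\<dots> \<le> real C ^ L * real n ^ (L div 2) * ?\<delta>"
    using len assms by (intro mult_right_mono mult_mono power_increasing div_le_mono sum_nonneg) auto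
  finally show ?thesis .
qed


section \<open>The complexity exponent\<close>

text \<open>A \<gamma> above the supremum fails the defining condition for every admissible L. The
  limsup is then at most 0, in particular below 1, so the quotient is eventually below 1.\<close>

lemma gamma_star_lessD:
  assumes less: "gamma_star \<l> c < ereal \<gamma>"
    and L: "1 \<le> L" "enat L \<le> (SUP n\<in>{1..}. \<l> n)"
    and "0 \<le> \<gamma>"
  shows "\<forall>\<^sub>F n in sequentially. ereal_of_enat (c n) ^ L * ereal (real n ^ (L div 2)) < ereal (real n powr \<gamma>)"
proof -
  let ?q = "\<lambda>n. ereal_of_enat (c n) ^ L * ereal (real n ^ (L div 2)) / ereal (real n powr \<gamma>)"
  have "\<not> 0 < limsup ?q"
  proof
    assume "0 < limsup ?q"
    then have "ereal \<gamma> \<le> gamma_star \<l> c"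
      unfolding gamma_star_def using L \<open>0 \<le> \<gamma>\<close> by (intro Sup_upper) blast
    with less show False by simp
  qed
  then have "limsup ?q \<le> 0" by (simp only: not_less)
  then have "limsup ?q < 1" by (rule order_le_less_trans) simp
  then have "\<forall>\<^sub>F n in sequentially. ?q n < 1" by (rule Limsup_lessD)
  with eventually_gt_at_top[of 0] show ?thesis
  proof eventually_elim
    case (elim n)
    then show ?case
      using L(1) by (cases "c n") (auto simp: divide_less_eq split: if_splits)
  qed
qed

text \<open>In \<open>ereal\<close> the supremum of the empty set is -\<infinity>, so a member has
  to be exhibited: \<gamma> = 0 with L = 1, where the quotient is c(n) \<ge> 1.\<close>

lemma gamma_star_nonneg:
  assumes c1: "\<And>n. 1 \<le> n \<Longrightarrow> 1 \<le> c n" and l2: "\<And>n. 1 \<le> n \<Longrightarrow> 2 \<le> \<l> n"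
  shows "0 \<le> gamma_star \<l> c"
proof -
  have c1': "1 \<le> ereal_of_enat (c n)" if "1 \<le> n" for n
    using c1[OF that] by (cases "c n") (auto simp: one_enat_def one_ereal_def)
  have "\<forall>\<^sub>F n in sequentially. 1 \<le> ereal_of_enat (c n) ^ 1 * ereal (real n ^ (1 div 2)) / ereal (real n powr 0)"
    using eventually_ge_at_top[of 1]
    by (rule eventually_mono) (use c1' in \<open>simp add: one_ereal_def[symmetric]\<close>)
  then have "1 \<le> limsup (\<lambda>n. ereal_of_enat (c n) ^ 1 * ereal (real n ^ (1 div 2)) / ereal (real n powr 0))"
    by (intro le_Limsup) auto
  then have *: "0 < limsup (\<lambda>n. ereal_of_enat (c n) ^ 1 * ereal (real n ^ (1 div 2)) / ereal (real n powr 0))"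
    by (rule order_less_le_trans[rotated]) simp
  have "enat 1 \<le> \<l> 1"
    by (rule order_trans[OF _ l2[of 1]]) (simp_all add: numeral_eq_enat)
  also have "\<l> 1 \<le> (SUP n\<in>{1..}. \<l> n)" by (intro SUP_upper) auto
  finally have "ereal 0 \<le> gamma_star \<l> c"
    unfolding gamma_star_def using *
    by (intro Sup_upper CollectI exI[of _ 0]) (auto intro!: exI[of _ 1])
  then show ?thesis by (simp only: zero_ereal_def)
qed

text \<open>A finite exponent makes both infinite options disappear: unbounded depth would admit
  arbitrarily high powers of n, and an infinite value of c would make the quotient infinite. What
  remains is a polynomial bound for all n \<ge> 1, not merely for large n.\<close>

lemma gamma_star_less_imp_bound:
  assumes c1: "\<And>n. 1 \<le> n \<Longrightarrow> 1 \<le> c n" and l2: "\<And>n. 1 \<le> n \<Longrightarrow> 2 \<le> \<l> n"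
    and mono: "mono_on {1..} c" and less: "gamma_star \<l> c < ereal \<gamma>"
  obtains L C K where "\<And>n. 1 \<le> n \<Longrightarrow> \<l> n \<le> enat L" "\<And>n. 1 \<le> n \<Longrightarrow> c n = enat (C n)"
    "\<And>n. 1 \<le> n \<Longrightarrow> real (C n) ^ L * real n ^ (L div 2) \<le> K * real n powr \<gamma>"
proof -
  have "0 < ereal \<gamma>"
    using gamma_star_nonneg[of c \<l>, OF c1 l2] less by (rule order_le_less_trans)
  then have \<gamma>: "0 < \<gamma>" by simp
  note ev = gamma_star_lessD[OF less _ _ less_imp_le[OF \<gamma>]]
  have c1': "1 \<le> ereal_of_enat (c n)" if "1 \<le> n" for n
    using c1[OF that] by (cases "c n") (auto simp: one_enat_def one_ereal_def)
  have one_le_pow: "1 \<le> x ^ k" if "1 \<le> x" for x :: ereal and k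
    using that by (cases x) (auto simp: one_ereal_def)
  have "(SUP n\<in>{1..}. \<l> n) \<noteq> \<infinity>"
  proof
    assume *: "(SUP n\<in>{1..}. \<l> n) = \<infinity>"
    \<comment> \<open>Depth 2 m contributes the factor n^m, which already dominates n^\<gamma> since
      m \<ge> \<gamma> and c(n) \<ge> 1.\<close>
    define m where "m = Suc (nat \<lceil>\<gamma>\<rceil>)"
    have "\<gamma> \<le> real m" unfolding m_def by linarith
    have "\<forall>\<^sub>F n in sequentially. ereal_of_enat (c n) ^ (2 * m) * ereal (real n ^ (2 * m div 2)) < ereal (real n powr \<gamma>)"
      unfolding m_def by (rule ev) (simp_all only: *, simp_all)
    then have "\<forall>\<^sub>F n::nat in sequentially. False"
      using eventually_ge_at_top[of 1]
    proof eventually_elim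
      case (elim n)
      have "ereal (real n powr \<gamma>) \<le> ereal (real n ^ m)"
        using \<open>\<gamma> \<le> real m\<close> elim(2) powr_mono[of \<gamma> "real m" "real n"] by (simp add: powr_realpow)
      also have "\<dots> \<le> ereal_of_enat (c n) ^ (2 * m) * ereal (real n ^ m)"
        using ereal_mult_right_mono[of 1 "ereal_of_enat (c n) ^ (2 * m)" "ereal (real n ^ m)"]
          one_le_pow[OF c1'[OF elim(2)], of "2 * m"]
        by simp
      finally show False using elim(1) by simp
    qed
    then show False by simp
  qed
  then obtain L where L: "(SUP n\<in>{1..}. \<l> n) = enat L" by auto
  have lL: "\<l> n \<le> enat L" if "1 \<le> n" for n
    unfolding L[symmetric] using that by (intro SUP_upper) auto
  have "1 \<le> L"
    using order_trans[OF l2[of 1] lL[of 1]] by (simp add: numeral_eq_enat)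
  from ev[OF this, unfolded L, OF order_refl] obtain N where
    N: "\<And>n. N \<le> n \<Longrightarrow> ereal_of_enat (c n) ^ L * ereal (real n ^ (L div 2)) < ereal (real n powr \<gamma>)"
    by (auto simp: eventually_sequentially)
  have fin_large: "c n \<noteq> \<infinity>" if "max 1 N \<le> n" for n
    using N[of n] that \<open>1 \<le> L\<close> by (cases "c n") auto
  \<comment> \<open>The asymptotic estimate gives finiteness for large n only; monotonicity of c
    carries it down to small n.\<close>
  have fin: "c n \<noteq> \<infinity>" if "1 \<le> n" for n
  proof -
    have "c n \<le> c (max n (max 1 N))"
      using that by (intro mono_onD[OF mono]) auto
    moreover have "c (max n (max 1 N)) \<noteq> \<infinity>" by (intro fin_large) simp
    ultimately show ?thesis by (cases "c n") auto
  qed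
  define C where "C n = the_enat (c n)" for n
  have C: "c n = enat (C n)" if "1 \<le> n" for n
    using fin[OF that] by (auto simp: C_def)
  define N' where "N' = max 1 N"
  \<comment> \<open>The summand 1 serves n \<ge> N'. For smaller n, monotonicity bounds the left
    side by its value at N', and n^\<gamma> \<ge> 1.\<close>
  define K where "K = 1 + real (C N') ^ L * real N' ^ (L div 2)"
  have "real (C n) ^ L * real n ^ (L div 2) \<le> K * real n powr \<gamma>" if n: "1 \<le> n" for n
  proof (cases "N' \<le> n")
    case True
    then have "real (C n) ^ L * real n ^ (L div 2) \<le> real n powr \<gamma>"
      using N[of n] C[OF n] by (simp add: N'_def)
    also have "\<dots> \<le> K * real n powr \<gamma>"
      using mult_right_mono[of 1 K "real n powr \<gamma>"] by (simp add: K_def)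
    finally show ?thesis .
  next
    case False
    have "c n \<le> c N'" using n False by (intro mono_onD[OF mono]) (auto simp: N'_def)
    then have "C n \<le> C N'" using C[of n] C[of N'] n by (simp add: N'_def)
    then have "real (C n) ^ L * real n ^ (L div 2) \<le> real (C N') ^ L * real N' ^ (L div 2)"
      using False by (intro mult_mono power_mono) auto
    also have "\<dots> \<le> K * 1" by (simp add: K_def)
    also have "\<dots> \<le> K * real n powr \<gamma>"
      using n \<gamma> by (intro mult_left_mono ge_one_powr_ge_zero) (auto simp: K_def intro: add_nonneg_nonneg)
    finally show ?thesis .
  qed
  with lL C show thesis by (rule that)
qed


section \<open>Uniform bounds from Lipschitz and integral bounds\<close>

text \<open>If the value at x0 were larger, |F| would exceed a / r^(d/p) on a cube of side r
  containing x0, because points there have l1 distance at most d r from x0. As that cube has volume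
  r^d, the integral of |F|^p would exceed a^p. The side r stays free, to be balanced later.\<close>

lemma sub_cube_estimate:
  fixes F :: "real^'d \<Rightarrow> real" and x0 :: "real^'d"
  assumes lip: "\<And>x y. \<bar>F x - F y\<bar> \<le> \<Lambda> * (\<Sum>i\<in>UNIV. \<bar>vec_nth x i - vec_nth y i\<bar>)"
    and "0 \<le> \<Lambda>" and r: "0 < r" "r \<le> 1" and "0 < p" and "0 \<le> a" and x0: "x0 \<in> unit_cube"
    and int: "(\<integral>\<^sup>+x. ennreal (\<bar>F x\<bar> powr p) \<partial>lebesgue_on unit_cube) \<le> ennreal (a powr p)"
  shows "\<bar>F x0\<bar> \<le> real CARD('d) * \<Lambda> * r + a / r powr (real CARD('d) / p)"
proof (rule ccontr)
  let ?d = "real CARD('d)"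
  define m where "m = \<bar>F x0\<bar> - ?d * \<Lambda> * r"
  assume "\<not> ?thesis"
  then have m: "a / r powr (?d / p) < m" by (simp add: m_def)
  have "0 \<le> a / r powr (?d / p)" using \<open>0 \<le> a\<close> by simp
  with m have "0 < m" by linarith
  \<comment> \<open>Near an upper face the corner is pushed back to 1 - r, so that the sub-cube
    keeps its full side r, stays in the unit cube and still contains x0.\<close>
  define l :: "real^'d" where "l = (\<chi> i. min (vec_nth x0 i) (1 - r))"
  define u :: "real^'d" where "u = (\<chi> i. vec_nth l i + r)"
  have x0': "0 \<le> vec_nth x0 i" "vec_nth x0 i \<le> 1" for i
    using x0 by (auto simp: mem_box_cart)
  have sub: "cbox l u \<subseteq> unit_cube"
  proof
    fix x assume x: "x \<in> cbox l u"
    have "0 \<le> vec_nth x i \<and> vec_nth x i \<le> 1" for i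
    proof -
      have "vec_nth l i \<le> vec_nth x i" "vec_nth x i \<le> vec_nth l i + r"
        using x by (auto simp: mem_box_cart u_def)
      then show ?thesis using x0'[of i] r by (auto simp: l_def)
    qed
    then show "x \<in> unit_cube" by (simp add: mem_box_cart)
  qed
  have dist: "\<bar>vec_nth x i - vec_nth x0 i\<bar> \<le> r" if "x \<in> cbox l u" for x i
  proof -
    have "vec_nth l i \<le> vec_nth x i" "vec_nth x i \<le> vec_nth l i + r"
      using that by (auto simp: mem_box_cart u_def)
    then show ?thesis using x0'[of i] r by (auto simp: l_def min_def split: if_splits)
  qed
  have low: "m \<le> \<bar>F x\<bar>" if "x \<in> cbox l u" for x
  proof -
    have "(\<Sum>i\<in>UNIV. \<bar>vec_nth x i - vec_nth x0 i\<bar>) \<le> ?d * r"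
      using sum_bounded_above[of UNIV "\<lambda>i. \<bar>vec_nth x i - vec_nth x0 i\<bar>" r] dist[OF that] by simp
    then have "\<Lambda> * (\<Sum>i\<in>UNIV. \<bar>vec_nth x i - vec_nth x0 i\<bar>) \<le> \<Lambda> * (?d * r)"
      using \<open>0 \<le> \<Lambda>\<close> by (rule mult_left_mono)
    with lip[of x x0] have "\<bar>F x - F x0\<bar> \<le> ?d * \<Lambda> * r" by (simp add: mult_ac)
    then show ?thesis unfolding m_def by linarith
  qed
  have "cbox l u \<noteq> {}"
    using r by (auto simp: interval_ne_empty_cart u_def)
  then have "measure lborel (cbox l u) = r ^ CARD('d)"
    by (simp add: content_cbox_cart u_def)
  then have "emeasure lborel (cbox l u) = ennreal (r ^ CARD('d))"
    by (subst emeasure_eq_ennreal_measure) (auto simp: emeasure_lborel_cbox_eq)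
  then have meas: "emeasure (lebesgue_on unit_cube) (cbox l u) = ennreal (r ^ CARD('d))"
    using sub by (subst emeasure_restrict_space) auto
  have "a powr p < m powr p * r ^ CARD('d)"
  proof -
    have "a < m * r powr (?d / p)"
      using m r by (simp add: field_simps)
    then have "a powr p < (m * r powr (?d / p)) powr p"
      using \<open>0 \<le> a\<close> \<open>0 < p\<close> by (intro powr_less_mono2) auto
    also have "\<dots> = m powr p * r ^ CARD('d)"
      using \<open>0 < p\<close> \<open>0 < m\<close> r by (simp add: powr_mult powr_powr powr_realpow)
    finally show ?thesis .
  qed
  moreover have "ennreal (m powr p * r ^ CARD('d)) \<le> ennreal (a powr p)"
  proof -
    have "cbox l u \<in> sets (lebesgue_on unit_cube)"
      using sub by (subst sets_restrict_space_iff) auto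
    then have "ennreal (m powr p * r ^ CARD('d)) =
      (\<integral>\<^sup>+x. ennreal (m powr p) * indicator (cbox l u) x \<partial>lebesgue_on unit_cube)"
      using r by (simp add: nn_integral_cmult_indicator meas ennreal_mult')
    also have "\<dots> \<le> (\<integral>\<^sup>+x. ennreal (\<bar>F x\<bar> powr p) \<partial>lebesgue_on unit_cube)"
      using low \<open>0 < m\<close> \<open>0 < p\<close>
      by (intro nn_integral_mono) (auto simp: indicator_def intro!: ennreal_leI powr_mono2)
    also note int
    finally show ?thesis .
  qed
  ultimately show False by (simp add: ennreal_le_iff)
qed

section \<open>Integrals of p-th powers and continuous representatives on the unit cube\<close>

lemma emeasure_unit_cube:
  "emeasure (lebesgue_on unit_cube) (unit_cube :: (real^'d) set) = 1"
proof -
  have "(cbox 0 1 :: (real^'d) set) \<noteq> {}"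
    by (simp add: interval_ne_empty_cart)
  then have "measure lborel (cbox 0 1 :: (real^'d) set) = 1"
    by (simp add: content_cbox_cart)
  then have "emeasure lborel (cbox 0 1 :: (real^'d) set) = 1"
    by (subst emeasure_eq_ennreal_measure) (auto simp: emeasure_lborel_cbox_eq)
  then show ?thesis by (subst emeasure_restrict_space) auto
qed

text \<open>A quasi-triangle inequality valid for every p > 0: |s - t| is at most twice the larger
  of |s| and |t|. The factor 2 powr (1 / p) comes from adding the two integrals.\<close>

lemma nn_integral_powr_diff_le:
  fixes u v :: "'a \<Rightarrow> real"
  assumes [measurable]: "u \<in> borel_measurable M" "v \<in> borel_measurable M"
    and "0 < p" and "0 \<le> a"
    and u: "(\<integral>\<^sup>+x. ennreal (\<bar>u x\<bar> powr p) \<partial>M) \<le> ennreal (a powr p)"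
    and v: "(\<integral>\<^sup>+x. ennreal (\<bar>v x\<bar> powr p) \<partial>M) \<le> ennreal (a powr p)"
  shows "(\<integral>\<^sup>+x. ennreal (\<bar>u x - v x\<bar> powr p) \<partial>M) \<le> ennreal ((2 * 2 powr (1 / p) * a) powr p)"
proof -
  have *: "\<bar>s - t\<bar> powr p \<le> 2 powr p * (\<bar>s\<bar> powr p + \<bar>t\<bar> powr p)" for s t :: real
  proof -
    have "\<bar>s - t\<bar> powr p \<le> (2 * max \<bar>s\<bar> \<bar>t\<bar>) powr p"
      using \<open>0 < p\<close> by (intro powr_mono2) auto
    also have "\<dots> = 2 powr p * max \<bar>s\<bar> \<bar>t\<bar> powr p" by (simp add: powr_mult)
    also have "\<dots> \<le> 2 powr p * (\<bar>s\<bar> powr p + \<bar>t\<bar> powr p)"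
      by (intro mult_left_mono) (auto simp: max_def)
    finally show ?thesis .
  qed
  have "(\<integral>\<^sup>+x. ennreal (\<bar>u x - v x\<bar> powr p) \<partial>M)
      \<le> (\<integral>\<^sup>+x. ennreal (2 powr p) * (ennreal (\<bar>u x\<bar> powr p) + ennreal (\<bar>v x\<bar> powr p)) \<partial>M)"
    using * by (intro nn_integral_mono)
      (simp add: ennreal_plus[symmetric] ennreal_mult[symmetric] del: ennreal_plus)
  also have "\<dots> = ennreal (2 powr p) *
      ((\<integral>\<^sup>+x. ennreal (\<bar>u x\<bar> powr p) \<partial>M) + (\<integral>\<^sup>+x. ennreal (\<bar>v x\<bar> powr p) \<partial>M))"
    by (simp add: nn_integral_cmult nn_integral_add)
  also have "\<dots> \<le> ennreal (2 powr p) * (ennreal (a powr p) + ennreal (a powr p))"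
    by (intro mult_left_mono add_mono u v) auto
  also have "\<dots> = ennreal (2 powr p * (2 * a powr p))"
    by (simp add: ennreal_plus[symmetric] ennreal_mult[symmetric] del: ennreal_plus)
  also have "2 powr p * (2 * a powr p) = (2 * 2 powr (1 / p) * a) powr p"
    using \<open>0 < p\<close> \<open>0 \<le> a\<close> by (simp add: powr_mult powr_powr)
  finally show ?thesis .
qed

text \<open>The finite bound a rules out the infinite branch of \<open>Lq_norm\<close>, so
  \<open>enn2real\<close> loses no information and the p-th root can be undone.\<close>

lemma nn_integral_powr_le_Lq_norm:
  fixes f :: "real^'d \<Rightarrow> real"
  assumes "Lq_norm (ennreal p) f \<le> ennreal a" and "0 < p" and "0 \<le> a"
  shows "(\<integral>\<^sup>+x. ennreal (\<bar>f x\<bar> powr p) \<partial>lebesgue_on unit_cube) \<le> ennreal (a powr p)"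
proof -
  let ?I = "\<integral>\<^sup>+x. ennreal (\<bar>f x\<bar> powr p) \<partial>lebesgue_on unit_cube"
  have "?I \<noteq> \<infinity>" and *: "enn2real ?I powr (1 / p) \<le> a"
    using assms by (auto simp: Lq_norm_def Let_def top_unique split: if_splits)
  from * have "(enn2real ?I powr (1 / p)) powr p \<le> a powr p"
    using \<open>0 < p\<close> by (intro powr_mono2) auto
  then have "enn2real ?I \<le> a powr p"
    using \<open>0 < p\<close> by (simp add: powr_powr)
  moreover have "?I = ennreal (enn2real ?I)"
    using \<open>?I \<noteq> \<infinity>\<close> by (simp add: top.not_eq_extremum)
  ultimately show ?thesis by (metis ennreal_leI)
qed

lemma Lq_norm_top_le:
  fixes f :: "real^'d \<Rightarrow> real"
  assumes "continuous_on unit_cube f" and "\<And>x. x \<in> unit_cube \<Longrightarrow> \<bar>f x\<bar> \<le> b"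
  shows "Lq_norm \<infinity> f \<le> ennreal b"
proof -
  have [measurable]: "f \<in> borel_measurable (lebesgue_on unit_cube)"
    using assms(1) by (intro continuous_imp_measurable_on_sets_lebesgue) auto
  show ?thesis
    unfolding Lq_norm_def using assms(2)
    by (auto intro!: esssup_I AE_I2 ennreal_leI)
qed

text \<open>The set of coincidence is closed and contains almost every point of the open cube, hence
  all of it, and the closed cube is the closure of the open one. It identifies the continuous
  representatives obtained from different scalings of one function.\<close>

lemma continuous_on_AE_eq_imp_eq:
  fixes f g :: "real^'d \<Rightarrow> real"
  assumes "continuous_on unit_cube f" "continuous_on unit_cube g"
    and ae: "AE x in lebesgue_on unit_cube. f x = g x" and "x \<in> unit_cube"
  shows "f x = g x"
proof -
  define C where "C = {x \<in> unit_cube. f x - g x = 0}"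
  have "closed C"
    unfolding C_def
    using continuous_closed_preimage[OF continuous_on_diff[OF assms(1,2)], of "{0}"]
    by (simp add: vimage_def Int_def conj_commute closed_cbox)
  have "AE x in lebesgue. x \<in> unit_cube \<longrightarrow> f x = g x"
    using ae by (subst (asm) AE_restrict_space_iff) auto
  then have "AE x\<in>box 0 1 in lebesgue. x \<in> C"
    by eventually_elim (use box_subset_cbox in \<open>auto simp: C_def\<close>)
  then have "box 0 1 \<subseteq> C"
    using mem_closed_if_AE_lebesgue_open[OF open_box \<open>closed C\<close>] by blast
  moreover have "box (0::real^'d) 1 \<noteq> {}"
    by (simp add: interval_ne_empty_cart)
  then have "closure (box (0::real^'d) 1) = unit_cube"
    by (rule closure_box)
  ultimately have "unit_cube \<subseteq> C"
    using \<open>closed C\<close> closure_minimal by metis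
  then show ?thesis using assms(4) by (auto simp: C_def)
qed

lemma continuous_on_if_l1_lipschitz:
  fixes F :: "real^'d \<Rightarrow> real"
  assumes "\<And>x y. \<bar>F x - F y\<bar> \<le> \<Lambda> * (\<Sum>i\<in>UNIV. \<bar>vec_nth x i - vec_nth y i\<bar>)"
  shows "continuous_on A F"
proof -
  have *: "((\<lambda>y. \<Lambda> * (\<Sum>i\<in>UNIV. \<bar>vec_nth y i - vec_nth x i\<bar>)) \<longlongrightarrow> 0) (at x within A)"
    for x :: "real^'d"
    by (auto intro!: tendsto_eq_intros)
  have "((\<lambda>y. F y - F x) \<longlongrightarrow> 0) (at x within A)" for x
    by (rule Lim_null_comparison[OF _ *[of x]]) (use assms in \<open>auto intro!: always_eventually\<close>)
  then show ?thesis
    by (auto simp: continuous_on_def LIM_zero_iff)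
qed

section \<open>Passage to the limit along dyadic scales\<close>

lemma geometric_increments_limit:
  fixes u :: "nat \<Rightarrow> real"
  assumes "\<And>k. \<bar>u k - u (Suc k)\<bar> \<le> C * q ^ k" and q: "0 < q" "q < 1"
  shows "\<exists>l. \<forall>k. \<bar>l - u k\<bar> \<le> C / (1 - q) * q ^ k"
proof -
  have "0 \<le> C" using assms(1)[of 0] by simp
  \<comment> \<open>Keeping the exact partial sum q^k - q^(k+m) of the geometric series, instead of
    q^k, lets the induction on m close.\<close>
  have bound: "\<bar>u (k + m) - u k\<bar> \<le> C / (1 - q) * (q ^ k - q ^ (k + m))" for k m
  proof (induction m)
    case (Suc m)
    have "\<bar>u (k + Suc m) - u k\<bar> \<le> C * q ^ (k + m) + C / (1 - q) * (q ^ k - q ^ (k + m))"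
      using Suc assms(1)[of "k + m"] by simp
    also have "C * q ^ (k + m) = C / (1 - q) * (q ^ (k + m) - q ^ (k + Suc m))"
      using q by (simp add: field_simps)
    finally show ?case by (simp add: algebra_simps)
  qed simp
  have "Cauchy u"
  proof (rule CauchyI')
    fix e :: real assume "0 < e"
    have "(\<lambda>k. C / (1 - q) * q ^ k) \<longlonglongrightarrow> C / (1 - q) * 0"
      using q by (intro tendsto_mult tendsto_const LIMSEQ_power_zero) auto
    then have "\<forall>\<^sub>F k in sequentially. C / (1 - q) * q ^ k < e"
      using \<open>0 < e\<close> by (intro order_tendstoD(2)) auto
    then obtain N where N: "\<And>k. N \<le> k \<Longrightarrow> C / (1 - q) * q ^ k < e"
      by (auto simp: eventually_sequentially)
    show "\<exists>M. \<forall>m\<ge>M. \<forall>n>m. dist (u m) (u n) < e"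
    proof (intro exI allI impI)
      fix m n assume "N \<le> m" "m < n"
      have "dist (u m) (u n) \<le> C / (1 - q) * (q ^ m - q ^ n)"
        using bound[of m "n - m"] \<open>m < n\<close> by (simp add: dist_real_def abs_minus_commute)
      also have "\<dots> \<le> C / (1 - q) * q ^ m"
        using q \<open>0 \<le> C\<close> by (intro mult_left_mono) auto
      also have "\<dots> < e" using N \<open>N \<le> m\<close> by blast
      finally show "dist (u m) (u n) < e" .
    qed
  qed
  then obtain l where l: "u \<longlonglongrightarrow> l" using Cauchy_convergent convergent_def by blast
  have "\<bar>l - u k\<bar> \<le> C / (1 - q) * q ^ k" for k
  proof (rule tendsto_upperbound)
    show "(\<lambda>m. \<bar>u (m + k) - u k\<bar>) \<longlonglongrightarrow> \<bar>l - u k\<bar>"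
      using l by (intro tendsto_intros LIMSEQ_ignore_initial_segment)
    have "\<bar>u (m + k) - u k\<bar> \<le> C / (1 - q) * q ^ k" for m
    proof -
      have "C / (1 - q) * (q ^ k - q ^ (k + m)) \<le> C / (1 - q) * q ^ k"
        using q \<open>0 \<le> C\<close> by (intro mult_left_mono) auto
      with bound[of k m] show ?thesis by (simp add: add.commute)
    qed
    then show "\<forall>\<^sub>F m in sequentially. \<bar>u (m + k) - u k\<bar> \<le> C / (1 - q) * q ^ k" by simp
  qed simp
  then show ?thesis by blast
qed

text \<open>The analytic core, for any increasing sets S n whose members have l1-Lipschitz constant
  K n^\<gamma>. The hypotheses on f say that its \<open>approx_Gamma\<close> is at most 1, and C is
  chosen before f, which is what an embedding constant requires.\<close>

lemma multiscale_limit: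
  fixes S :: "nat \<Rightarrow> (real^'d \<Rightarrow> real) set" and p \<alpha> \<gamma> K :: real
  defines "\<mu> \<equiv> p / (real CARD('d) + p) * (\<alpha> - real CARD('d) / p * \<gamma>)"
  assumes "0 < p" and "0 \<le> \<gamma>" and "0 \<le> \<alpha>" and \<gamma>_less: "\<gamma> < p / real CARD('d) * \<alpha>" and "0 \<le> K"
    and S_mono: "\<And>n m. 1 \<le> n \<Longrightarrow> n \<le> m \<Longrightarrow> S n \<subseteq> S m"
    and S_lip: "\<And>n g x y. 1 \<le> n \<Longrightarrow> g \<in> S n \<Longrightarrow>
      \<bar>g x - g y\<bar> \<le> K * real n powr \<gamma> * (\<Sum>i\<in>UNIV. \<bar>vec_nth x i - vec_nth y i\<bar>)"
  shows "\<exists>C\<ge>1. \<forall>f\<in>borel_measurable (lebesgue_on unit_cube). Lq_norm (ennreal p) f \<le> 1 \<longrightarrow>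
           (\<forall>n\<ge>1. ennreal (real n powr \<alpha>) * Lq_dist (ennreal p) f (S n) \<le> 1) \<longrightarrow>
           (\<exists>g. continuous_on unit_cube g \<and> (AE x in lebesgue_on unit_cube. g x = f x) \<and>
             (\<forall>x\<in>unit_cube. \<bar>g x\<bar> \<le> C) \<and>
             (\<forall>n\<ge>1. \<exists>\<phi>\<in>S n. \<forall>x\<in>unit_cube. \<bar>g x - \<phi> x\<bar> \<le> C * real n powr - \<mu>))"
proof -
  let ?d = "real CARD('d)"
  let ?M = "lebesgue_on (unit_cube :: (real^'d) set)"
  have d: "0 < ?d" by simp
  have "?d / p * \<gamma> < \<alpha>"
    using \<gamma>_less \<open>0 < p\<close> d by (simp add: field_simps)
  then have \<mu>: "0 < \<mu>"
    using \<open>0 < p\<close> d by (simp add: \<mu>_def)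
  \<comment> \<open>The equation that determines \<mu>: the integral term of the sub-cube estimate
    decays at the same rate as the Lipschitz term.\<close>
  have balance: "- \<alpha> + (\<mu> + \<gamma>) * (?d / p) = - \<mu>"
  proof -
    have "\<mu> * (?d + p) = p * \<alpha> - ?d * \<gamma>"
    proof -
      have "\<mu> * (?d + p) = p * (\<alpha> - ?d / p * \<gamma>)"
        using \<open>0 < p\<close> d add_pos_pos[of ?d p] by (simp add: \<mu>_def)
      also have "\<dots> = p * \<alpha> - ?d * \<gamma>"
        using \<open>0 < p\<close> by (simp add: algebra_simps)
      finally show ?thesis .
    qed
    then show ?thesis using \<open>0 < p\<close> by (simp add: divide_simps algebra_simps)
  qed
  define q where "q = 2 powr - \<mu>"
  have q: "0 < q" "q < 1"
    using \<mu> by (auto simp: q_def powr_less_one)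
  have qpow: "q ^ k = 2 powr (- \<mu> * real k)" for k
    unfolding powr_realpow[OF q(1), symmetric] by (simp add: q_def powr_powr)
  \<comment> \<open>A is the quasi-triangle constant, C1 bounds the increments relative to q^k, and
    C2 sums the geometric series. In C, the part C1 + C2 bounds g, C2 * 2 powr \<mu> pays for
    passing from powers of 2 to general n, and 1 ensures C \<ge> 1.\<close>
  define A where "A = 2 * 2 powr (1 / p)"
  have "0 < A" by (simp add: A_def)
  define C1 where "C1 = ?d * (K + K * 2 powr \<gamma>) + A * 2"
  define C2 where "C2 = C1 / (1 - q)"
  define C where "C = 1 + C1 + C2 + C2 * 2 powr \<mu>"
  have "0 \<le> C1" unfolding C1_def using \<open>0 \<le> K\<close> \<open>0 < A\<close> by auto
  then have "0 \<le> C2" unfolding C2_def using q by simp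
  have "1 \<le> C" unfolding C_def using \<open>0 \<le> C1\<close> \<open>0 \<le> C2\<close> by simp
  show ?thesis
  proof (intro exI[of _ C] conjI \<open>1 \<le> C\<close> ballI impI)
    fix f :: "real^'d \<Rightarrow> real"
    assume [measurable]: "f \<in> borel_measurable ?M"
      and f_le: "Lq_norm (ennreal p) f \<le> 1"
      and f_dist: "\<forall>n\<ge>1. ennreal (real n powr \<alpha>) * Lq_dist (ennreal p) f (S n) \<le> 1"
    \<comment> \<open>Twice the guaranteed distance at n = 2^k: the infimum in
      \<open>Lq_dist\<close> need not be attained, and the factor 2 leaves room for an actual
      approximant.\<close>
    define e where "e k = 2 * 2 powr (- \<alpha> * real k)" for k :: nat
    have e_pos: "0 < e k" for k by (simp add: e_def)
    have e_anti: "e (Suc k) \<le> e k" for k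
    proof -
      have "2 powr (- \<alpha> * real (Suc k)) \<le> 2 powr (- \<alpha> * real k)"
        using \<open>0 \<le> \<alpha>\<close> by (intro powr_mono) (auto simp: algebra_simps)
      then show ?thesis by (simp add: e_def)
    qed
    have "\<exists>g\<in>S (2 ^ k). Lq_norm (ennreal p) (\<lambda>x. f x - g x) < ennreal (e k)" for k
    proof (rule ccontr)
      assume neg: "\<not> ?thesis"
      have "ennreal (e k) \<le> Lq_dist (ennreal p) f (S (2 ^ k))"
        unfolding Lq_dist_def using neg by (intro INF_greatest) (auto simp: not_less)
      then have "ennreal (real (2 ^ k) powr \<alpha>) * ennreal (e k)
          \<le> ennreal (real (2 ^ k) powr \<alpha>) * Lq_dist (ennreal p) f (S (2 ^ k))"
        by (rule mult_left_mono) simp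
      also have "\<dots> \<le> 1" using f_dist[rule_format, of "2 ^ k"] by simp
      also have "ennreal (real (2 ^ k) powr \<alpha>) * ennreal (e k) = ennreal 2"
      proof -
        have "real (2 ^ k) powr \<alpha> * e k = 2"
          by (simp add: e_def powr_realpow[symmetric] powr_powr powr_minus mult.commute)
        then show ?thesis by (metis e_pos ennreal_mult' less_imp_le mult.commute)
      qed
      finally have "ennreal 2 \<le> ennreal 1" by simp
      then show False by (subst (asm) ennreal_le_iff) auto
    qed
    then obtain F where F: "\<And>k. F k \<in> S (2 ^ k)"
      and F_close: "\<And>k. Lq_norm (ennreal p) (\<lambda>x. f x - F k x) < ennreal (e k)"
      by metis
    have F_lip: "\<bar>F k x - F k y\<bar>
        \<le> K * 2 powr (\<gamma> * real k) * (\<Sum>i\<in>UNIV. \<bar>vec_nth x i - vec_nth y i\<bar>)" for k x y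
      using S_lip[OF _ F[of k], of x y]
      by (simp add: powr_realpow[symmetric] powr_powr mult.commute)
    have F_cont: "continuous_on unit_cube (F k)" for k
      using F_lip by (rule continuous_on_if_l1_lipschitz)
    have [measurable]: "F k \<in> borel_measurable ?M" for k
      using F_cont by (intro continuous_imp_measurable_on_sets_lebesgue) auto
    have F_int: "(\<integral>\<^sup>+x. ennreal (\<bar>f x - F k x\<bar> powr p) \<partial>?M) \<le> ennreal (e j powr p)" if "e k \<le> e j" for k j
      using that F_close[of k] e_pos[of j] \<open>0 < p\<close>
      by (intro nn_integral_powr_le_Lq_norm) (auto intro: less_imp_le order_trans ennreal_leI)
    have step: "\<bar>F k x - F (Suc k) x\<bar> \<le> C1 * q ^ k" if x: "x \<in> unit_cube" for k x
    proof -
      \<comment> \<open>This side length makes both terms of the sub-cube estimate of order \<open>2 powr (- \<mu> * k)\<close>.\<close>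
      define r where "r = 2 powr (- (\<mu> + \<gamma>) * real k)"
      define \<Lambda> where "\<Lambda> = (K + K * 2 powr \<gamma>) * 2 powr (\<gamma> * real k)"
      have r: "0 < r" "r \<le> 1"
        using \<mu> \<open>0 \<le> \<gamma>\<close> powr_mono[of "- (\<mu> + \<gamma>) * real k" 0 2]
        by (auto simp: r_def mult_le_0_iff)
      have "\<bar>F k x - F (Suc k) x\<bar> \<le> ?d * \<Lambda> * r + A * e k / r powr (?d / p)"
      proof (rule sub_cube_estimate[OF _ _ r \<open>0 < p\<close> _ x])
        fix y z :: "real^'d"
        let ?\<delta> = "\<Sum>i\<in>UNIV. \<bar>vec_nth y i - vec_nth z i\<bar>"
        have "\<bar>(F k y - F (Suc k) y) - (F k z - F (Suc k) z)\<bar>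
            \<le> \<bar>F k y - F k z\<bar> + \<bar>F (Suc k) y - F (Suc k) z\<bar>" by linarith
        also have "\<dots> \<le> K * 2 powr (\<gamma> * real k) * ?\<delta> + K * 2 powr (\<gamma> * real (Suc k)) * ?\<delta>"
          by (intro add_mono F_lip)
        also have "\<dots> = \<Lambda> * ?\<delta>"
          by (simp add: \<Lambda>_def powr_add algebra_simps)
        finally show "\<bar>(F k y - F (Suc k) y) - (F k z - F (Suc k) z)\<bar> \<le> \<Lambda> * ?\<delta>" .
      next
        show "0 \<le> \<Lambda>" using \<open>0 \<le> K\<close> by (simp add: \<Lambda>_def)
        show "0 \<le> A * e k" using \<open>0 < A\<close> e_pos[of k] by simp
        \<comment> \<open>Both approximants are compared with f, which cancels; as e decreases, e k
          serves for both levels.\<close>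
        have "(\<integral>\<^sup>+x. ennreal (\<bar>(f x - F (Suc k) x) - (f x - F k x)\<bar> powr p) \<partial>?M)
            \<le> ennreal ((2 * 2 powr (1 / p) * e k) powr p)"
          using \<open>0 < p\<close> e_pos[of k] e_anti
          by (intro nn_integral_powr_diff_le F_int) (auto intro: less_imp_le)
        then show "(\<integral>\<^sup>+x. ennreal (\<bar>F k x - F (Suc k) x\<bar> powr p) \<partial>?M) \<le> ennreal ((A * e k) powr p)"
          by (simp add: A_def)
      qed
      then have "\<bar>F k x - F (Suc k) x\<bar> \<le> ?d * (\<Lambda> * r) + A * (e k / r powr (?d / p))"
        by (simp add: mult.assoc)
      also have "\<Lambda> * r = (K + K * 2 powr \<gamma>) * q ^ k"
        by (simp add: \<Lambda>_def r_def qpow powr_add[symmetric] algebra_simps)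
      also have "e k / r powr (?d / p) = 2 * q ^ k"
      proof -
        have "e k / r powr (?d / p) = 2 * 2 powr (real k * (- \<alpha> + (\<mu> + \<gamma>) * (?d / p)))"
          by (simp add: e_def r_def powr_powr powr_minus[symmetric] powr_add[symmetric] divide_inverse
              algebra_simps)
        then show ?thesis unfolding balance by (simp add: qpow mult.commute)
      qed
      finally show ?thesis by (simp add: C1_def algebra_simps)
    qed
    \<comment> \<open>The sub-cube estimate with r = 1, that is, on the whole cube. The bound 1 for
      f is relaxed to 2 = e 0 so that the quasi-triangle inequality applies with a common
      constant.\<close>
    have F0: "\<bar>F 0 x\<bar> \<le> C1" if x: "x \<in> unit_cube" for x
    proof -
      have "\<bar>F 0 x\<bar> \<le> ?d * K * 1 + A * 2 / 1 powr (?d / p)"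
      proof (rule sub_cube_estimate[OF _ \<open>0 \<le> K\<close> _ _ \<open>0 < p\<close> _ x])
        show "\<bar>F 0 y - F 0 z\<bar> \<le> K * (\<Sum>i\<in>UNIV. \<bar>vec_nth y i - vec_nth z i\<bar>)" for y z
          using F_lip[of 0 y z] by simp
        have "(\<integral>\<^sup>+x. ennreal (\<bar>f x\<bar> powr p) \<partial>?M) \<le> ennreal (2 powr p)"
          using \<open>0 < p\<close> f_le by (intro nn_integral_powr_le_Lq_norm) (auto intro: order_trans)
        then have "(\<integral>\<^sup>+x. ennreal (\<bar>f x - (f x - F 0 x)\<bar> powr p) \<partial>?M)
            \<le> ennreal ((2 * 2 powr (1 / p) * 2) powr p)"
          using \<open>0 < p\<close> F_int[of 0 0]
          by (intro nn_integral_powr_diff_le) (auto simp: e_def)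
        then show "(\<integral>\<^sup>+x. ennreal (\<bar>F 0 x\<bar> powr p) \<partial>?M) \<le> ennreal ((A * 2) powr p)"
          by (simp add: A_def)
      qed (use \<open>0 < A\<close> in auto)
      also have "\<dots> \<le> C1"
        using \<open>0 \<le> K\<close> d by (simp add: C1_def distrib_left)
      finally show ?thesis .
    qed
    have "\<exists>l. \<forall>k. \<bar>l - F k x\<bar> \<le> C2 * q ^ k" if "x \<in> unit_cube" for x
      unfolding C2_def using step[OF that] q by (rule geometric_increments_limit)
    then obtain g where g: "\<And>x k. x \<in> unit_cube \<Longrightarrow> \<bar>g x - F k x\<bar> \<le> C2 * q ^ k"
      by metis
    have to_0: "(\<lambda>k. C2 * q ^ k) \<longlonglongrightarrow> 0"
      using q by (auto intro!: tendsto_eq_intros LIMSEQ_power_zero)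
    have "uniform_limit unit_cube F g sequentially"
    proof (rule uniform_limitI)
      fix \<epsilon> :: real assume "0 < \<epsilon>"
      from order_tendstoD(2)[OF to_0 this]
      show "\<forall>\<^sub>F k in sequentially. \<forall>x\<in>unit_cube. dist (F k x) (g x) < \<epsilon>"
      proof eventually_elim
        case (elim k)
        show ?case
        proof
          fix x :: "real^'d" assume "x \<in> unit_cube"
          from g[OF this, of k] elim show "dist (F k x) (g x) < \<epsilon>" by (simp add: dist_real_def)
        qed
      qed
    qed
    then have g_cont: "continuous_on unit_cube g"
      using F_cont by (intro uniform_limit_theorem[of _ F]) auto
    then have [measurable]: "g \<in> borel_measurable ?M"
      by (intro continuous_imp_measurable_on_sets_lebesgue) auto
    \<comment> \<open>The F k approach f in L^p and g uniformly, so the fixed integral of |f - g|^p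
      lies below a null sequence; a k dominates both errors.\<close>
    have ae: "AE x in ?M. g x = f x"
    proof -
      define a where "a k = max (e k) (C2 * q ^ k)" for k
      have a_lim: "(\<lambda>k. ennreal ((A * a k) powr p)) \<longlonglongrightarrow> ennreal 0"
      proof (rule tendsto_ennrealI)
        have "(\<lambda>k. e k) \<longlonglongrightarrow> 2 * 0"
        proof -
          have "\<alpha> > 0" using \<gamma>_less \<open>0 \<le> \<gamma>\<close> \<open>0 < p\<close> d
            by (metis order_le_less_trans zero_less_mult_pos divide_pos_pos)
          then have "(\<lambda>k. (2 powr - \<alpha>) ^ k) \<longlonglongrightarrow> 0"
            by (intro LIMSEQ_power_zero) (auto simp: powr_less_one)
          moreover have "e k = 2 * (2 powr - \<alpha>) ^ k" for k
            by (simp add: e_def powr_realpow[symmetric] powr_powr)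
          ultimately show ?thesis by (auto intro!: tendsto_intros)
        qed
        then have "(\<lambda>k. A * a k) \<longlonglongrightarrow> A * max 0 0"
          unfolding a_def using to_0 by (intro tendsto_intros) auto
        then have "(\<lambda>k. (A * a k) powr p) \<longlonglongrightarrow> 0 powr p"
          using \<open>0 < p\<close> \<open>0 < A\<close> e_pos
          by (intro tendsto_powr' tendsto_const)
             (auto intro!: always_eventually mult_nonneg_nonneg simp: a_def le_max_iff_disj less_imp_le)
        then show "(\<lambda>k. (A * a k) powr p) \<longlonglongrightarrow> 0" using \<open>0 < p\<close> by simp
      qed
      have "(\<integral>\<^sup>+x. ennreal (\<bar>f x - g x\<bar> powr p) \<partial>?M) \<le> ennreal ((A * a k) powr p)" for k
      proof -
        have "(\<integral>\<^sup>+x. ennreal (\<bar>f x - F k x\<bar> powr p) \<partial>?M) \<le> ennreal (e k powr p)"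
          by (rule F_int) simp
        also have "\<dots> \<le> ennreal (a k powr p)"
          using e_pos[of k] \<open>0 < p\<close> by (intro ennreal_leI powr_mono2) (auto simp: a_def)
        finally have 1: "(\<integral>\<^sup>+x. ennreal (\<bar>f x - F k x\<bar> powr p) \<partial>?M) \<le> ennreal (a k powr p)" .
        have "(\<integral>\<^sup>+x. ennreal (\<bar>g x - F k x\<bar> powr p) \<partial>?M) \<le> (\<integral>\<^sup>+x. ennreal (a k powr p) \<partial>?M)"
          using g \<open>0 < p\<close>
          by (intro nn_integral_mono ennreal_leI powr_mono2) (auto simp: a_def le_max_iff_disj)
        also have "\<dots> = ennreal (a k powr p)"
          by (simp add: emeasure_unit_cube)
        finally have "(\<integral>\<^sup>+x. ennreal (\<bar>(f x - F k x) - (g x - F k x)\<bar> powr p) \<partial>?M)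
            \<le> ennreal ((2 * 2 powr (1 / p) * a k) powr p)"
          using 1 \<open>0 < p\<close> e_pos[of k] by (intro nn_integral_powr_diff_le) (auto simp: a_def le_max_iff_disj less_imp_le)
        then show ?thesis by (simp add: A_def)
      qed
      then have "(\<integral>\<^sup>+x. ennreal (\<bar>f x - g x\<bar> powr p) \<partial>?M) \<le> ennreal 0"
        using a_lim by (intro LIMSEQ_le_const) auto
      then have "AE x in ?M. ennreal (\<bar>f x - g x\<bar> powr p) = 0"
        by (subst nn_integral_0_iff_AE[symmetric]) auto
      then show ?thesis by eventually_elim auto
    qed
    have g_le: "\<bar>g x\<bar> \<le> C" if "x \<in> unit_cube" for x
    proof -
      have "\<bar>g x\<bar> \<le> C1 + C2"
        using g[OF that, of 0] F0[OF that] by simp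
      moreover have "0 \<le> C2 * 2 powr \<mu>" using \<open>0 \<le> C2\<close> by simp
      ultimately show ?thesis by (simp add: C_def)
    qed
    have approx: "\<exists>\<phi>\<in>S n. \<forall>x\<in>unit_cube. \<bar>g x - \<phi> x\<bar> \<le> C * real n powr - \<mu>" if n: "1 \<le> n" for n
    proof -
      \<comment> \<open>The approximant for n is that of the largest power of 2 below or equal to n;
        it lies in S n by monotonicity, at the price of a factor 2 powr \<mu>.\<close>
      obtain k where k: "2 ^ k \<le> n" "n < 2 ^ (k + 1)"
        using ex_power_ivl1[of 2 n] n by auto
      have "F k \<in> S n" using F[of k] S_mono[of "2 ^ k" n] k by auto
      moreover have "C2 * q ^ k \<le> C * real n powr - \<mu>"
      proof -
        have "real n \<le> 2 ^ (k + 1)" using k(2) by (metis less_imp_le of_nat_le_iff of_nat_numeral of_nat_power)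
        then have "(2 ^ (k + 1)) powr - \<mu> \<le> real n powr - \<mu>"
          using n \<mu> by (intro powr_mono2') auto
        also have "(2 ^ (k + 1)) powr - \<mu> = 2 powr - \<mu> * q ^ k"
          by (simp add: qpow powr_realpow[symmetric] powr_powr powr_add[symmetric] powr_mult algebra_simps)
        finally have "2 powr \<mu> * (2 powr - \<mu> * q ^ k) \<le> 2 powr \<mu> * real n powr - \<mu>"
          by (rule mult_left_mono) simp
        then have "q ^ k \<le> 2 powr \<mu> * real n powr - \<mu>"
          by (simp add: mult.assoc[symmetric] powr_add[symmetric])
        then have "C2 * q ^ k \<le> C2 * (2 powr \<mu> * real n powr - \<mu>)"
          using \<open>0 \<le> C2\<close> by (rule mult_left_mono)
        also have "\<dots> \<le> C * real n powr - \<mu>"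
          using \<open>0 \<le> C1\<close> \<open>0 \<le> C2\<close> unfolding mult.assoc[symmetric] C_def
          by (intro mult_right_mono) auto
        finally show ?thesis .
      qed
      ultimately show ?thesis using g order_trans by (metis (no_types, lifting))
    qed
    show "\<exists>g. continuous_on unit_cube g \<and> (AE x in ?M. g x = f x) \<and>
        (\<forall>x\<in>unit_cube. \<bar>g x\<bar> \<le> C) \<and>
        (\<forall>n\<ge>1. \<exists>\<phi>\<in>S n. \<forall>x\<in>unit_cube. \<bar>g x - \<phi> x\<bar> \<le> C * real n powr - \<mu>)"
      using g_cont ae g_le approx by blast
  qed
qed


section \<open>Embeddings\<close>

text \<open>A bound valid for every admissible t passes to the infimum, attained or not. Dividing by
  C first leaves a plain lower bound for the set of such t.\<close>

lemma le_approx_norm: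
  assumes "0 < C" and "\<And>t. 0 < t \<Longrightarrow> approx_Gamma \<l> c s q (\<lambda>x. f x / t) \<le> 1 \<Longrightarrow> N \<le> ennreal (C * t)"
  shows "N \<le> ennreal C * approx_norm \<l> c s q f"
proof -
  have "ennreal (1 / C) * N \<le> approx_norm \<l> c s q f"
    unfolding approx_norm_def
  proof (rule Inf_greatest, clarify)
    fix t :: real assume "0 < t" "approx_Gamma \<l> c s q (\<lambda>x. f x / t) \<le> 1"
    then have "ennreal (1 / C) * N \<le> ennreal (1 / C) * ennreal (C * t)"
      using assms(2) by (intro mult_left_mono) auto
    also have "\<dots> = ennreal t"
      using \<open>0 < C\<close> \<open>0 < t\<close> by (simp add: ennreal_mult[symmetric])
    finally show "ennreal (1 / C) * N \<le> ennreal t" .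
  qed
  then have "ennreal C * (ennreal (1 / C) * N) \<le> ennreal C * approx_norm \<l> c s q f"
    by (rule mult_left_mono) simp
  also have "ennreal C * (ennreal (1 / C) * N) = N"
    using \<open>0 < C\<close> by (simp add: mult.assoc[symmetric] ennreal_mult[symmetric])
  finally show ?thesis .
qed

text \<open>The same g serves both embeddings. The multiscale result is applied to f / t for every
  admissible t, not just for one, so that the resulting bounds C t can be optimised over t.\<close>

lemma approx_space_continuous_version:
  fixes p \<alpha> \<gamma> :: real and \<l> c :: "nat \<Rightarrow> enat"
  defines "\<mu> \<equiv> p / (real CARD('d) + p) * (\<alpha> - real CARD('d) / p * \<gamma>)"
  assumes "0 < p" and "0 < \<alpha>"
    and l2: "\<And>n. 1 \<le> n \<Longrightarrow> 2 \<le> \<l> n" and c1: "\<And>n. 1 \<le> n \<Longrightarrow> 1 \<le> c n"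
    and l_mono: "mono_on {1..} \<l>" and c_mono: "mono_on {1..} c"
    and less: "gamma_star \<l> c < ereal \<gamma>" and \<gamma>_less: "\<gamma> < p / real CARD('d) * \<alpha>"
  obtains C where "0 < C"
    and "\<And>f :: real^'d \<Rightarrow> real. f \<in> approx_space \<l> c \<alpha> (ennreal p) \<Longrightarrow>
      \<exists>g. g \<in> cont_space \<and> g \<in> approx_space \<l> c \<mu> \<infinity> \<and> (AE x in lebesgue_on unit_cube. g x = f x) \<and>
        sup_norm g \<le> ennreal C * approx_norm \<l> c \<alpha> (ennreal p) f \<and>
        approx_norm \<l> c \<mu> \<infinity> g \<le> ennreal C * approx_norm \<l> c \<alpha> (ennreal p) f"
proof -
  let ?S = "nn_functions \<l> c :: nat \<Rightarrow> (real^'d \<Rightarrow> real) set"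
  let ?M = "lebesgue_on (unit_cube :: (real^'d) set)"
  have "0 \<le> \<gamma>"
    using order_le_less_trans[OF gamma_star_nonneg[of c \<l>, OF c1 l2] less] by simp
  obtain L Cn K where lL: "\<And>n. 1 \<le> n \<Longrightarrow> \<l> n \<le> enat L" and cC: "\<And>n. 1 \<le> n \<Longrightarrow> c n = enat (Cn n)"
    and K: "\<And>n. 1 \<le> n \<Longrightarrow> real (Cn n) ^ L * real n ^ (L div 2) \<le> K * real n powr \<gamma>"
    using gamma_star_less_imp_bound[of c \<l>, OF c1 l2 c_mono less] by blast
  have Cn: "1 \<le> Cn n" if "1 \<le> n" for n
    using c1[OF that] cC[OF that] by (simp add: one_enat_def)
  have "0 \<le> K" using K[of 1] order_trans[of 0 "real (Cn 1) ^ L" K] by simp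
  have S_mono: "?S n \<subseteq> ?S m" if "1 \<le> n" "n \<le> m" for n m
    using that by (intro nn_functions_mono mono_onD[OF l_mono] mono_onD[OF c_mono]) auto
  have S_lip: "\<bar>g x - g y\<bar> \<le> K * real n powr \<gamma> * (\<Sum>i\<in>UNIV. \<bar>vec_nth x i - vec_nth y i\<bar>)"
    if "1 \<le> n" "g \<in> ?S n" for n g x y
  proof -
    have "\<bar>g x - g y\<bar> \<le> real (Cn n) ^ L * real n ^ (L div 2) * (\<Sum>i\<in>UNIV. \<bar>vec_nth x i - vec_nth y i\<bar>)"
      using that by (intro nn_functions_lipschitz[of _ \<l> c] lL cC Cn)
    also have "\<dots> \<le> K * real n powr \<gamma> * (\<Sum>i\<in>UNIV. \<bar>vec_nth x i - vec_nth y i\<bar>)"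
      using K that by (intro mult_right_mono sum_nonneg) auto
    finally show ?thesis .
  qed
  have S_cont: "continuous_on unit_cube g" if "1 \<le> n" "g \<in> ?S n" for n g
    using S_lip[OF that] by (rule continuous_on_if_l1_lipschitz)
  obtain C where "1 \<le> C" and C: "\<forall>f\<in>borel_measurable ?M. Lq_norm (ennreal p) f \<le> 1 \<longrightarrow>
           (\<forall>n\<ge>1. ennreal (real n powr \<alpha>) * Lq_dist (ennreal p) f (?S n) \<le> 1) \<longrightarrow>
           (\<exists>g. continuous_on unit_cube g \<and> (AE x in ?M. g x = f x) \<and>
             (\<forall>x\<in>unit_cube. \<bar>g x\<bar> \<le> C) \<and>
             (\<forall>n\<ge>1. \<exists>\<phi>\<in>?S n. \<forall>x\<in>unit_cube. \<bar>g x - \<phi> x\<bar> \<le> C * real n powr - \<mu>))"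
    using multiscale_limit[where S = ?S, OF \<open>0 < p\<close> \<open>0 \<le> \<gamma>\<close> less_imp_le[OF \<open>0 < \<alpha>\<close>] \<gamma>_less
        \<open>0 \<le> K\<close> S_mono S_lip, folded \<mu>_def] by blast
  have "0 < C" using \<open>1 \<le> C\<close> by simp
  show thesis
  proof (rule that[OF \<open>0 < C\<close>])
    fix f :: "real^'d \<Rightarrow> real" assume f: "f \<in> approx_space \<l> c \<alpha> (ennreal p)"
    have [measurable]: "f \<in> borel_measurable ?M" using f by (simp add: approx_space_def)
    define T where "T = {t. 0 < t \<and> approx_Gamma \<l> c \<alpha> (ennreal p) (\<lambda>x. f x / t) \<le> 1}"
    have ex: "\<exists>g. continuous_on unit_cube g \<and> (AE x in ?M. g x = f x / t) \<and>
             (\<forall>x\<in>unit_cube. \<bar>g x\<bar> \<le> C) \<and>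
             (\<forall>n\<ge>1. \<exists>\<phi>\<in>?S n. \<forall>x\<in>unit_cube. \<bar>g x - \<phi> x\<bar> \<le> C * real n powr - \<mu>)" if "t \<in> T" for t
      using that by (intro C[rule_format]) (auto simp: T_def approx_Gamma_def SUP_le_iff)
    have "approx_norm \<l> c \<alpha> (ennreal p) f < \<infinity>" using f by (simp add: approx_space_def)
    then have "T \<noteq> {}"
      by (auto simp: approx_norm_def T_def Inf_less_iff)
    then obtain t0 where "t0 \<in> T" by blast
    then have "0 < t0" by (simp add: T_def)
    obtain g0 where g0: "continuous_on unit_cube g0" "AE x in ?M. g0 x = f x / t0"
      using ex[OF \<open>t0 \<in> T\<close>] by blast
    \<comment> \<open>Built from one arbitrary admissible t0, which exists because the quasi-norm of
      f is finite.\<close>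
    define g where "g x = t0 * g0 x" for x
    have g_cont: "continuous_on unit_cube g"
      unfolding g_def using g0(1) by (intro continuous_intros)
    have g_ae: "AE x in ?M. g x = f x"
      using g0(2) by eventually_elim (use \<open>0 < t0\<close> in \<open>simp add: g_def\<close>)
    have g_t: "(\<forall>x\<in>unit_cube. \<bar>g x / t\<bar> \<le> C) \<and>
        (\<forall>n\<ge>1. \<exists>\<phi>\<in>?S n. \<forall>x\<in>unit_cube. \<bar>g x / t - \<phi> x\<bar> \<le> C * real n powr - \<mu>)" if "t \<in> T" for t
    proof -
      have "0 < t" using that by (simp add: T_def)
      obtain h where h: "continuous_on unit_cube h" "AE x in ?M. h x = f x / t"
        "\<forall>x\<in>unit_cube. \<bar>h x\<bar> \<le> C"
        "\<forall>n\<ge>1. \<exists>\<phi>\<in>?S n. \<forall>x\<in>unit_cube. \<bar>h x - \<phi> x\<bar> \<le> C * real n powr - \<mu>"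
        using ex[OF \<open>t \<in> T\<close>] by blast
      \<comment> \<open>The representative produced for t is continuous and agrees almost everywhere
        with g / t, hence everywhere on the cube; its bounds thus become bounds for g.\<close>
      have eq: "g x / t = h x" if "x \<in> unit_cube" for x
      proof (rule continuous_on_AE_eq_imp_eq[OF _ h(1) _ that])
        show "continuous_on unit_cube (\<lambda>x. g x / t)"
          using g_cont \<open>0 < t\<close> by (intro continuous_intros) auto
        show "AE x in ?M. g x / t = h x"
          using g_ae h(2) by eventually_elim simp
      qed
      then show ?thesis using h(3,4) by simp
    qed
    have sup_le: "sup_norm g \<le> ennreal (C * t)" if "t \<in> T" for t
    proof -
      have "0 < t" using that by (simp add: T_def)
      then show ?thesis
        unfolding sup_norm_def using g_t[OF that]
        by (intro SUP_least ennreal_leI) (auto simp: field_simps abs_mult)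
    qed
    have Gamma_le: "approx_Gamma \<l> c \<mu> \<infinity> (\<lambda>x. g x / (C * t)) \<le> 1" if "t \<in> T" for t
    proof -
      have "0 < t" using that by (simp add: T_def)
      have cont: "continuous_on unit_cube (\<lambda>x. g x / (C * t))"
        using g_cont \<open>0 < C\<close> \<open>0 < t\<close> by (intro continuous_intros) auto
      have "Lq_norm \<infinity> (\<lambda>x. g x / (C * t)) \<le> ennreal 1"
      proof (rule Lq_norm_top_le[OF cont])
        fix x :: "real^'d" assume "x \<in> unit_cube"
        with g_t[OF that] have "\<bar>g x / t\<bar> \<le> C" by blast
        then show "\<bar>g x / (C * t)\<bar> \<le> 1"
          using \<open>0 < C\<close> \<open>0 < t\<close> by (simp add: abs_mult field_simps)
      qed
      moreover have "ennreal (real n powr \<mu>) * Lq_dist \<infinity> (\<lambda>x. g x / (C * t)) (?S n) \<le> 1"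
        if n: "1 \<le> n" for n
      proof -
        obtain \<phi> where \<phi>: "\<phi> \<in> ?S n" "\<forall>x\<in>unit_cube. \<bar>g x / t - \<phi> x\<bar> \<le> C * real n powr - \<mu>"
          using g_t[OF \<open>t \<in> T\<close>] n by blast
        \<comment> \<open>Dividing g / t by C reduces the error to n powr -\<mu>; the approximant
          must be divided too, and stays in the same set because 1 / C \<le> 1.\<close>
        let ?\<psi> = "\<lambda>x. 1 / C * \<phi> x"
        have \<psi>: "?\<psi> \<in> ?S n"
          using \<phi>(1) \<open>1 \<le> C\<close> by (intro nn_functions_scale) auto
        have "Lq_dist \<infinity> (\<lambda>x. g x / (C * t)) (?S n) \<le> Lq_norm \<infinity> (\<lambda>x. g x / (C * t) - ?\<psi> x)"
          unfolding Lq_dist_def by (rule INF_lower[OF \<psi>])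
        also have "\<dots> \<le> ennreal (real n powr - \<mu>)"
        proof (rule Lq_norm_top_le)
          show "continuous_on unit_cube (\<lambda>x. g x / (C * t) - ?\<psi> x)"
            using cont S_cont[OF n \<psi>] by (rule continuous_on_diff)
          fix x :: "real^'d" assume "x \<in> unit_cube"
          with \<phi> have "\<bar>g x / t - \<phi> x\<bar> / C \<le> real n powr - \<mu>"
            using \<open>0 < C\<close> by (simp add: pos_divide_le_eq mult.commute)
          moreover have "\<bar>g x / (C * t) - ?\<psi> x\<bar> = \<bar>g x / t - \<phi> x\<bar> / C"
          proof -
            have "g x / (C * t) - ?\<psi> x = (g x / t - \<phi> x) / C"
              by (simp add: diff_divide_distrib mult.commute)
            then show ?thesis using \<open>0 < C\<close> by simp
          qed
          ultimately show "\<bar>g x / (C * t) - ?\<psi> x\<bar> \<le> real n powr - \<mu>" by simp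
        qed
        finally have "ennreal (real n powr \<mu>) * Lq_dist \<infinity> (\<lambda>x. g x / (C * t)) (?S n)
            \<le> ennreal (real n powr \<mu>) * ennreal (real n powr - \<mu>)"
          by (rule mult_left_mono) simp
        also have "\<dots> = 1"
          using n by (simp add: ennreal_mult[symmetric] powr_add[symmetric])
        finally show ?thesis .
      qed
      ultimately show ?thesis
        by (auto simp: approx_Gamma_def intro!: SUP_least)
    qed
    have norm_le: "approx_norm \<l> c \<mu> \<infinity> g \<le> ennreal (C * t)" if "t \<in> T" for t
      unfolding approx_norm_def
      using Gamma_le[OF that] that \<open>0 < C\<close> by (intro Inf_lower) (auto simp: T_def)
    have "g \<in> approx_space \<l> c \<mu> \<infinity>"
    proof -
      have "g \<in> borel_measurable ?M"
        using g_cont by (intro continuous_imp_measurable_on_sets_lebesgue) auto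
      moreover have "Lq_norm \<infinity> g \<le> ennreal (C * t0)"
      proof (rule Lq_norm_top_le[OF g_cont])
        fix x :: "real^'d" assume "x \<in> unit_cube"
        with g_t[OF \<open>t0 \<in> T\<close>] have "\<bar>g x / t0\<bar> \<le> C" by blast
        then show "\<bar>g x\<bar> \<le> C * t0"
          using \<open>0 < t0\<close> by (simp add: field_simps)
      qed
      ultimately show ?thesis
        using norm_le[OF \<open>t0 \<in> T\<close>] by (auto simp: approx_space_def intro: order_le_less_trans)
    qed
    moreover have "sup_norm g \<le> ennreal C * approx_norm \<l> c \<alpha> (ennreal p) f"
      using sup_le by (intro le_approx_norm \<open>0 < C\<close>) (simp add: T_def)
    moreover have "approx_norm \<l> c \<mu> \<infinity> g \<le> ennreal C * approx_norm \<l> c \<alpha> (ennreal p) f"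
      using norm_le by (intro le_approx_norm \<open>0 < C\<close>) (simp add: T_def)
    ultimately show "\<exists>g. g \<in> cont_space \<and> g \<in> approx_space \<l> c \<mu> \<infinity> \<and> (AE x in ?M. g x = f x) \<and>
        sup_norm g \<le> ennreal C * approx_norm \<l> c \<alpha> (ennreal p) f \<and>
        approx_norm \<l> c \<mu> \<infinity> g \<le> ennreal C * approx_norm \<l> c \<alpha> (ennreal p) f"
      using g_cont g_ae by (auto simp: cont_space_def)
  qed
qed

theorem theorem3p3:
  fixes p \<alpha> :: real and \<l> c :: "nat \<Rightarrow> enat"
  assumes "0 < p" and "0 < \<alpha>"
    and "\<And>n. 1 \<le> n \<Longrightarrow> 2 \<le> \<l> n" and "\<And>n. 1 \<le> n \<Longrightarrow> 1 \<le> c n"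
    and "mono_on {1..} \<l>" and "mono_on {1..} c"
    and "gamma_star \<l> c < \<infinity>"
  shows
    "(ereal \<alpha> > ereal (real CARD('d::finite) / p) * gamma_star \<l> c \<longrightarrow>
        embeds (approx_space \<l> c \<alpha> (ennreal p) :: (real^'d \<Rightarrow> real) set)
               (approx_norm \<l> c \<alpha> (ennreal p))
               cont_space sup_norm) \<and>
     (\<forall>\<gamma>::real. gamma_star \<l> c < ereal \<gamma> \<and> \<gamma> < p / real CARD('d) * \<alpha> \<longrightarrow>
        (let \<mu> = p / (real CARD('d) + p) * (\<alpha> - real CARD('d) / p * \<gamma>)
         in embeds (approx_space \<l> c \<alpha> (ennreal p) :: (real^'d \<Rightarrow> real) set)
                   (approx_norm \<l> c \<alpha> (ennreal p))
                   (approx_space \<l> c \<mu> \<infinity>) (approx_norm \<l> c \<mu> \<infinity>)))"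
proof (intro conjI impI allI)
  assume gt: "ereal (real CARD('d) / p) * gamma_star \<l> c < ereal \<alpha>"
  have "0 \<le> gamma_star \<l> c" using assms(3,4) by (intro gamma_star_nonneg)
  then obtain g where g: "gamma_star \<l> c = ereal g"
    using assms(7) by (cases "gamma_star \<l> c") auto
  then have "g < p / real CARD('d) * \<alpha>"
    using gt \<open>0 < p\<close> by (simp add: field_simps)
  \<comment> \<open>The hypothesis on \<alpha> leaves a gap between the exponent and p \<alpha> / d;
    any \<gamma> in this gap yields the continuous representative.\<close>
  then obtain \<gamma> where "g < \<gamma>" "\<gamma> < p / real CARD('d) * \<alpha>" using dense by blast
  then have \<gamma>: "gamma_star \<l> c < ereal \<gamma>" "\<gamma> < p / real CARD('d) * \<alpha>" by (simp_all add: g)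
  let ?\<mu> = "p / (real CARD('d) + p) * (\<alpha> - real CARD('d) / p * \<gamma>)"
  show "embeds (approx_space \<l> c \<alpha> (ennreal p) :: (real^'d \<Rightarrow> real) set)
               (approx_norm \<l> c \<alpha> (ennreal p)) cont_space sup_norm"
  proof (rule approx_space_continuous_version[OF assms(1-6) \<gamma>])
    fix C :: real
    assume "0 < C" and *: "\<And>f :: real^'d \<Rightarrow> real. f \<in> approx_space \<l> c \<alpha> (ennreal p) \<Longrightarrow>
      \<exists>g. g \<in> cont_space \<and> g \<in> approx_space \<l> c ?\<mu> \<infinity> \<and> (AE x in lebesgue_on unit_cube. g x = f x) \<and>
        sup_norm g \<le> ennreal C * approx_norm \<l> c \<alpha> (ennreal p) f \<and>
        approx_norm \<l> c ?\<mu> \<infinity> g \<le> ennreal C * approx_norm \<l> c \<alpha> (ennreal p) f"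
    show ?thesis
      unfolding embeds_def Let_def
      by (intro exI[of _ C] conjI ballI \<open>0 < C\<close>) (use * in fast)
  qed
next
  fix \<gamma> :: real
  assume "gamma_star \<l> c < ereal \<gamma> \<and> \<gamma> < p / real CARD('d) * \<alpha>"
  then have \<gamma>: "gamma_star \<l> c < ereal \<gamma>" "\<gamma> < p / real CARD('d) * \<alpha>" by auto
  let ?\<mu> = "p / (real CARD('d) + p) * (\<alpha> - real CARD('d) / p * \<gamma>)"
  show "let \<mu> = p / (real CARD('d) + p) * (\<alpha> - real CARD('d) / p * \<gamma>)
         in embeds (approx_space \<l> c \<alpha> (ennreal p) :: (real^'d \<Rightarrow> real) set)
                   (approx_norm \<l> c \<alpha> (ennreal p))
                   (approx_space \<l> c \<mu> \<infinity>) (approx_norm \<l> c \<mu> \<infinity>)"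
  proof (rule approx_space_continuous_version[OF assms(1-6) \<gamma>])
    fix C :: real
    assume "0 < C" and *: "\<And>f :: real^'d \<Rightarrow> real. f \<in> approx_space \<l> c \<alpha> (ennreal p) \<Longrightarrow>
      \<exists>g. g \<in> cont_space \<and> g \<in> approx_space \<l> c ?\<mu> \<infinity> \<and> (AE x in lebesgue_on unit_cube. g x = f x) \<and>
        sup_norm g \<le> ennreal C * approx_norm \<l> c \<alpha> (ennreal p) f \<and>
        approx_norm \<l> c ?\<mu> \<infinity> g \<le> ennreal C * approx_norm \<l> c \<alpha> (ennreal p) f"
    show ?thesis
      unfolding embeds_def Let_def
      by (intro exI[of _ C] conjI ballI \<open>0 < C\<close>) (use * in fast)
  qed
qed

end
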